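(* Let $G$ be a finite group that is a central product of its normal subgroups $G_1$ and $G_2$, and let $H$ be a finite group that is a central product of its normal subgroups $H_1$ and $H_2$. Put $Z_1=G_1'\cap G_2'$ and $Z_2=H_1'\cap H_2'$. Suppose that there are an isomorphism $\bar\phi:H^2(G/Z_1,\mathbb C^\times)\to H^2(H/Z_2,\mathbb C^\times)$ such that $G/Z_1\sim_{\mathbb C}H/Z_2$ via the map $\bar\phi$, and an isomorphism $\bar i:\mathrm{Hom}(Z_1,\mathbb C^\times)\to\mathrm{Hom}(Z_2,\mathbb C^\times)$, such that $$\bar\phi\circ\mathrm{tra}_1=\mathrm{tra}_2\circ\bar i,$$ where $\mathrm{tra}_1:\mathrm{Hom}(Z_1,\mathbb C^\times)\to H^2(G/Z_1,\mathbb C^\times)$ and $\mathrm{tra}_2:\mathrm{Hom}(Z_2,\mathbb C^\times)\to H^2(H/Z_2,\mathbb C^\times)$ are the transgression maps associated with the central extensions $1\to Z_1\to G\to G/Z_1\to1$ and $1\to Z_2\to H\to H/Z_2\to1$. Then $G\sim_{\mathbb C}H$.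
   Context: A group $G$ is a central product of its normal subgroups $G_1$ and $G_2$ (amalgamating $A$) if $G=G_1G_2$, $A=G_1\cap G_2$ and $[G_1,G_2]=1$. $K'$ denotes the derived subgroup of a group $K$. For a finite group $G$, $Z^2(G,\mathbb C^\times)$ is the group of $2$-cocycles with trivial $G$-action on $\mathbb C^\times$, and $H^2(G,\mathbb C^\times)$ is the second cohomology group. For $\alpha\in Z^2(G,\mathbb C^\times)$, the twisted group algebra $\mathbb C^\alpha G$ is the $\mathbb C$-vector space with basis $\{\bar g: g\in G\}$ and multiplication determined by $\bar g\,\bar h=\alpha(g,h)\overline{gh}$; up to isomorphism it depends only on the class $[\alpha]$. For finite groups $G,H$ we say $G\sim_{\mathbb C}H$ via the map $\phi$ if $\phi:H^2(G,\mathbb C^\times)\to H^2(H,\mathbb C^\times)$ is a group isomorphism such that $\mathbb C^\alpha G\cong\mathbb C^{\phi(\alpha)}H$ (as $\mathbb C$-algebras) for every $[\alpha]\in H^2(G,\mathbb C^\times)$, where $\phi(\alpha)$ denotes a cocycle representing $\phi([\alpha])$. We write $G\sim_{\mathbb C}H$ if such a $\phi$ exists. Transgression: for a central extension $1\to Z\to G\to G/Z\to 1$ with a section $\mu: G/Z\to G$, $\mathrm{tra}:\mathrm{Hom}(Z,\mathbb C^\times)\to H^2(G/Z,\mathbb C^\times)$ sends $\chi$ to the class of $(x,y)\mapsto\chi(\mu(x)\mu(y)\mu(xy)^{-1})$. *)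

theory Defs
  imports Complex_Main "HOL-Algebra.Algebra" "HOL-Algebra.Algebraic_Closure_Type"
begin

definition central_product :: "('a, 'm) monoid_scheme \<Rightarrow> 'a set \<Rightarrow> 'a set \<Rightarrow> bool" where
  "central_product G G1 G2 \<longleftrightarrow>
     normal G1 G \<and> normal G2 G \<and> carrier G = G1 <#>\<^bsub>G\<^esub> G2 \<and>
     (\<forall>x\<in>G1. \<forall>y\<in>G2. x \<otimes>\<^bsub>G\<^esub> y \<otimes>\<^bsub>G\<^esub> inv\<^bsub>G\<^esub> x \<otimes>\<^bsub>G\<^esub> inv\<^bsub>G\<^esub> y = \<one>\<^bsub>G\<^esub>)"

abbreviation complex_units :: "complex monoid" where
  "complex_units \<equiv> units_of (ring_of_type_algebra :: complex ring)"

text \<open>Functions with a prescribed domain are represented by the extensional functions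
  (the value outside the domain is \<^const>\<open>undefined\<close>), so that equality of functions is
  equality on the domain. The groups of characters and of cocycles are
  subgroups of a power of the multiplicative group of nonzero complex numbers, with pointwise
  multiplication.\<close>

definition character_group :: "('a, 'm) monoid_scheme \<Rightarrow> 'a set \<Rightarrow> ('a \<Rightarrow> complex) monoid" where
  "character_group G Z =
     (product_group Z (\<lambda>_. complex_units))
       \<lparr>carrier := hom (G\<lparr>carrier := Z\<rparr>) complex_units \<inter> extensional Z\<rparr>"

definition cocycles :: "('a, 'm) monoid_scheme \<Rightarrow> ('a \<times> 'a \<Rightarrow> complex) set" where
  "cocycles G =
     {\<alpha> \<in> carrier G \<times> carrier G \<rightarrow>\<^sub>E carrier complex_units.
        \<forall>x\<in>carrier G. \<forall>y\<in>carrier G. \<forall>z\<in>carrier G.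
          \<alpha> (x, y) * \<alpha> (x \<otimes>\<^bsub>G\<^esub> y, z) = \<alpha> (y, z) * \<alpha> (x, y \<otimes>\<^bsub>G\<^esub> z)}"

definition coboundaries :: "('a, 'm) monoid_scheme \<Rightarrow> ('a \<times> 'a \<Rightarrow> complex) set" where
  "coboundaries G =
     {(\<lambda>(x, y)\<in>carrier G \<times> carrier G. f x * f y / f (x \<otimes>\<^bsub>G\<^esub> y)) | f.
        f \<in> carrier G \<rightarrow> carrier complex_units}"

definition cocycle_group :: "('a, 'm) monoid_scheme \<Rightarrow> ('a \<times> 'a \<Rightarrow> complex) monoid" where
  "cocycle_group G =
     (product_group (carrier G \<times> carrier G) (\<lambda>_. complex_units))\<lparr>carrier := cocycles G\<rparr>"

definition second_cohomology :: "('a, 'm) monoid_scheme \<Rightarrow> ('a \<times> 'a \<Rightarrow> complex) set monoid" where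
  "second_cohomology G = cocycle_group G Mod coboundaries G"

definition cohomology_class ::
    "('a, 'm) monoid_scheme \<Rightarrow> ('a \<times> 'a \<Rightarrow> complex) \<Rightarrow> ('a \<times> 'a \<Rightarrow> complex) set" where
  "cohomology_class G \<alpha> = coboundaries G #>\<^bsub>cocycle_group G\<^esub> \<alpha>"

text \<open>An element of the twisted group algebra is its coordinate function with respect to the
  standard basis indexed by the group. Cocycles need not be normalized, so the unit of the algebra
  is \<open>\<alpha>(1,1)\<^sup>-\<^sup>1\<close> times the basis vector of the group identity.\<close>

definition twisted_group_algebra ::
    "('a, 'm) monoid_scheme \<Rightarrow> ('a \<times> 'a \<Rightarrow> complex) \<Rightarrow> (complex, 'a \<Rightarrow> complex) module" where
  "twisted_group_algebra G \<alpha> =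
     \<lparr>carrier = carrier G \<rightarrow>\<^sub>E UNIV,
      monoid.mult = (\<lambda>a b. \<lambda>x\<in>carrier G.
        \<Sum>(g, h) \<in> {(g, h) \<in> carrier G \<times> carrier G. g \<otimes>\<^bsub>G\<^esub> h = x}. a g * b h * \<alpha> (g, h)),
      one = (\<lambda>x\<in>carrier G. if x = \<one>\<^bsub>G\<^esub> then inverse (\<alpha> (\<one>\<^bsub>G\<^esub>, \<one>\<^bsub>G\<^esub>)) else 0),
      ring.zero = (\<lambda>x\<in>carrier G. 0),
      add = (\<lambda>a b. \<lambda>x\<in>carrier G. a x + b x),
      module.smult = (\<lambda>c a. \<lambda>x\<in>carrier G. c * a x)\<rparr>"

definition algebra_isomorphic ::
    "(complex, 'a, 'm) module_scheme \<Rightarrow> (complex, 'b, 'n) module_scheme \<Rightarrow> bool" where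
  "algebra_isomorphic A B \<longleftrightarrow>
     (\<exists>f \<in> ring_iso A B. \<forall>c. \<forall>a\<in>carrier A. f (c \<odot>\<^bsub>A\<^esub> a) = c \<odot>\<^bsub>B\<^esub> f a)"

text \<open>\<open>\<beta>\<close> ranges over all cocycles representing the image of the class of \<open>\<alpha>\<close>.\<close>

definition sim_via ::
    "('a, 'm) monoid_scheme \<Rightarrow> ('b, 'n) monoid_scheme
      \<Rightarrow> (('a \<times> 'a \<Rightarrow> complex) set \<Rightarrow> ('b \<times> 'b \<Rightarrow> complex) set) \<Rightarrow> bool" where
  "sim_via G H \<phi> \<longleftrightarrow>
     \<phi> \<in> iso (second_cohomology G) (second_cohomology H) \<and>
     (\<forall>\<alpha>\<in>cocycles G. \<forall>\<beta>\<in>\<phi> (cohomology_class G \<alpha>).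
        algebra_isomorphic (twisted_group_algebra G \<alpha>) (twisted_group_algebra H \<beta>))"

definition sim :: "('a, 'm) monoid_scheme \<Rightarrow> ('b, 'n) monoid_scheme \<Rightarrow> bool" where
  "sim G H \<longleftrightarrow> (\<exists>\<phi>. sim_via G H \<phi>)"

definition is_section :: "('a, 'm) monoid_scheme \<Rightarrow> 'a set \<Rightarrow> ('a set \<Rightarrow> 'a) \<Rightarrow> bool" where
  "is_section G Z \<mu> \<longleftrightarrow>
     \<mu> \<in> carrier (G Mod Z) \<rightarrow> carrier G \<and> (\<forall>x\<in>carrier (G Mod Z). Z #>\<^bsub>G\<^esub> \<mu> x = x)"

definition transgression ::
    "('a, 'm) monoid_scheme \<Rightarrow> 'a set \<Rightarrow> ('a set \<Rightarrow> 'a)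
      \<Rightarrow> ('a \<Rightarrow> complex) \<Rightarrow> ('a set \<times> 'a set \<Rightarrow> complex) set" where
  "transgression G Z \<mu> \<chi> =
     cohomology_class (G Mod Z)
       (\<lambda>(x, y)\<in>carrier (G Mod Z) \<times> carrier (G Mod Z).
          \<chi> (\<mu> x \<otimes>\<^bsub>G\<^esub> \<mu> y \<otimes>\<^bsub>G\<^esub> inv\<^bsub>G\<^esub> (\<mu> (x \<otimes>\<^bsub>G Mod Z\<^esub> y))))"

end

theory Submission
  imports Defs "HOL-Computational_Algebra.Fundamental_Theorem_Algebra"
begin

text \<open>Let \<open>Z = G1' \<inter> G2'\<close>. For a cocycle \<open>\<alpha>\<close> on \<open>G\<close> and commuting \<open>x\<close>, \<open>y\<close> the quotient
  \<open>\<alpha>(x, y) / \<alpha>(y, x)\<close> is multiplicative in each variable, hence trivial on \<open>G1' \<times> G2\<close> and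
  \<open>G1 \<times> G2'\<close>. So \<open>\<alpha>\<close> is symmetric between \<open>Z\<close> and \<open>G\<close>; as a symmetric cocycle on a finite abelian
  group is a coboundary, \<open>\<alpha>\<close> is cohomologous to a cocycle inflated from \<open>G/Z\<close>. Thus
  \<open>H\<^sup>2(G)\<close> is the quotient of \<open>H\<^sup>2(G/Z)\<close> by the image of the transgression, and the given
  isomorphism descends to the second cohomology groups of \<open>G\<close> and \<open>H\<close>. On the algebra side, the
  Fourier transform along \<open>Z\<close> identifies the twisted group algebra of an inflated cocycle \<open>a\<close> with the
  product over all characters \<open>\<chi>\<close> of \<open>Z\<close> of the algebras of \<open>G/Z\<close> twisted by \<open>a \<cdot> tra \<chi>\<close>, and these
  products correspond factor by factor.\<close>

subsection \<open>Symmetric cocycles on finite abelian groups\<close>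

text \<open>The symmetric cocycle on \<open>Z\<close> is trivialized without decomposing
  \<open>Z\<close> into cyclic groups. Translations twisted by the cocycle commute because it is
  symmetric, and each satisfies an equation \<open>T^n = c\<close> on functions supported in the
  group; the eigenvalues of a common eigenvector form the trivializing function. For the constant
  cocycle 1 the same construction produces characters, and prescribing an eigenvalue other than 1 at
  one element yields enough of them for Fourier inversion. For any central \<open>Z\<close> the
  kernel of inflation from \<open>G/Z\<close> is the image of the transgression. Surjectivity of
  inflation is what the central product contributes, through the symmetry of cocycles between
  \<open>Z\<close> and \<open>G\<close>. The compatibility of the two transgressions serves twice:
  it matches the kernels of the two inflation maps, and it tells which factor of one product of
  algebras corresponds to which factor of the other. Neither cocycles nor sections are normalized;
  this accounts for constants such as \<open>a(1,1)\<close>.\<close>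

text \<open>For \<open>u k = T\<^sup>k v\<close> with \<open>T\<close> linear, this is an eigenvector of \<open>T\<close> in the span of the orbit
  of \<open>v\<close>; stating it for sequences avoids any mention of \<open>T\<close>. It is \<open>q(T) v\<close> for a factor \<open>q\<close> of \<open>p\<close>,
  so that whatever commutes with \<open>T\<close> and has \<open>v\<close> as an eigenvector also has the new one.\<close>

lemma eigenvector_of_sequence:
  fixes u :: "nat \<Rightarrow> 'b \<Rightarrow> complex" and p :: "complex poly"
  assumes "p \<noteq> 0" and "u 0 x0 \<noteq> 0"
    and "\<And>x. (\<Sum>k\<le>Polynomial.degree p. Polynomial.coeff p k * u k x) = 0"
  obtains l q where "poly p l = 0" and "\<exists>x. (\<Sum>k\<le>Polynomial.degree q. Polynomial.coeff q k * u k x) \<noteq> 0"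
    and "\<And>x. (\<Sum>k\<le>Polynomial.degree q. Polynomial.coeff q k * u (Suc k) x)
            = l * (\<Sum>k\<le>Polynomial.degree q. Polynomial.coeff q k * u k x)"
proof -
  have "\<exists>l q. poly p l = 0 \<and> (\<exists>x. (\<Sum>k\<le>Polynomial.degree q. Polynomial.coeff q k * u k x) \<noteq> 0)
    \<and> (\<forall>x. (\<Sum>k\<le>Polynomial.degree q. Polynomial.coeff q k * u (Suc k) x)
            = l * (\<Sum>k\<le>Polynomial.degree q. Polynomial.coeff q k * u k x))"
    using assms(1,3)
  proof (induction "Polynomial.degree p" arbitrary: p)
    case 0
    then have "Polynomial.coeff p 0 \<noteq> 0"
      by (metis leading_coeff_0_iff)
    with "0.hyps" "0.prems"(2)[of x0] assms(2) show ?case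
      by simp
  next
    case (Suc d p)
    then have "\<not> constant (poly p)"
      by (simp add: constant_degree)
    then obtain l where l: "poly p l = 0"
      using fundamental_theorem_of_algebra by blast
    then obtain q where q: "p = [:- l, 1:] * q"
      by (auto simp: poly_eq_0_iff_dvd elim: dvdE)
    with Suc.prems have q0: "q \<noteq> 0"
      by auto
    then have "Polynomial.degree p = Suc (Polynomial.degree q)"
      unfolding q by (subst Polynomial.degree_mult_eq) auto
    with Suc.hyps have d: "Polynomial.degree q = d" and dp: "Polynomial.degree p = Suc d"
      by auto
    have rel: "(\<Sum>k\<le>d. Polynomial.coeff q k * u (Suc k) x)
                = l * (\<Sum>k\<le>d. Polynomial.coeff q k * u k x)" for x
    proof -
      have "Polynomial.coeff p k = Polynomial.coeff (pCons 0 q) k - l * Polynomial.coeff q k" for k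
        unfolding q by simp
      then have "0 = (\<Sum>k\<le>Suc d. Polynomial.coeff (pCons 0 q) k * u k x)
                  - (\<Sum>k\<le>Suc d. l * Polynomial.coeff q k * u k x)"
        using Suc.prems(2)[of x] by (simp add: dp left_diff_distrib sum_subtractf del: sum.atMost_Suc)
      also have "(\<Sum>k\<le>Suc d. Polynomial.coeff (pCons 0 q) k * u k x)
                  = (\<Sum>k\<le>d. Polynomial.coeff q k * u (Suc k) x)"
        by (subst sum.atMost_Suc_shift) simp
      also have "(\<Sum>k\<le>Suc d. l * Polynomial.coeff q k * u k x)
                  = l * (\<Sum>k\<le>d. Polynomial.coeff q k * u k x)"
        using d by (simp add: Polynomial.coeff_eq_0 sum_distrib_left mult.assoc)
      finally show ?thesis
        by simp
    qed
    show ?case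
    \<comment> \<open>Either \<open>q(T) v\<close> is nonzero and is the eigenvector sought, with
      eigenvalue \<open>l\<close>, or \<open>q\<close> is an annihilating polynomial of smaller
      degree whose roots are roots of \<open>p\<close>.\<close>
    proof (cases "\<exists>x. (\<Sum>k\<le>d. Polynomial.coeff q k * u k x) \<noteq> 0")
      case True
      with rel l d show ?thesis
        by blast
    next
      case False
      then have "\<exists>l' q'. poly q l' = 0 \<and> (\<exists>x. (\<Sum>k\<le>Polynomial.degree q'. Polynomial.coeff q' k * u k x) \<noteq> 0)
        \<and> (\<forall>x. (\<Sum>k\<le>Polynomial.degree q'. Polynomial.coeff q' k * u (Suc k) x)
            = l' * (\<Sum>k\<le>Polynomial.degree q'. Polynomial.coeff q' k * u k x))"
        by (intro Suc.hyps(1)) (use d q0 in auto)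
      then show ?thesis
        unfolding q by auto
    qed
  qed
  then show thesis
    using that by blast
qed

text \<open>Stated for a bare function instead of an element of \<open>cocycles K\<close>: a cocycle
  on \<open>G\<close> is in general not extensional on \<open>Z\<close> x \<open>Z\<close>, yet has
  to be an instance over \<open>Z\<close>. The constant 1 is the other instance.\<close>

locale symmetric_cocycle = comm_group K for K :: "('a, 'm) monoid_scheme" (structure) +
  fixes a :: "'a \<times> 'a \<Rightarrow> complex"
  assumes finite_carrier: "finite (carrier K)"
    and nonzero: "\<lbrakk>x \<in> carrier K; y \<in> carrier K\<rbrakk> \<Longrightarrow> a (x, y) \<noteq> 0"
    and cocycle: "\<lbrakk>x \<in> carrier K; y \<in> carrier K; z \<in> carrier K\<rbrakk>
      \<Longrightarrow> a (x, y) * a (x \<otimes> y, z) = a (y, z) * a (x, y \<otimes> z)"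
    and symmetric: "\<lbrakk>x \<in> carrier K; y \<in> carrier K\<rbrakk> \<Longrightarrow> a (x, y) = a (y, x)"
begin

text \<open>Translations satisfy \<open>T\<^sub>z T\<^sub>y = a(z, y) T\<^sub>z\<^sub>y\<close>, so the eigenvalues of a common eigenvector
  trivialize \<open>a\<close>.\<close>

definition transl :: "'a \<Rightarrow> ('a \<Rightarrow> complex) \<Rightarrow> 'a \<Rightarrow> complex" where
  "transl z v = (\<lambda>w. if w \<in> carrier K then a (w, z) * v (w \<otimes> z) else 0)"

lemma transl_scale: "transl z (\<lambda>x. c * v x) = (\<lambda>x. c * transl z v x)"
  by (auto simp: transl_def)

lemma transl_sum: "transl z (\<lambda>x. \<Sum>k\<in>I. c k * V k x) = (\<lambda>x. \<Sum>k\<in>I. c k * transl z (V k) x)"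
  by (auto simp: transl_def sum_distrib_left mult.left_commute)

lemma transl_transl:
  assumes "z \<in> carrier K" and "y \<in> carrier K"
  shows "transl z (transl y v) = (\<lambda>w. a (z, y) * transl (z \<otimes> y) v w)"
proof
  fix w
  show "transl z (transl y v) w = a (z, y) * transl (z \<otimes> y) v w"
  proof (cases "w \<in> carrier K")
    case True
    with assms cocycle[of w z y] have "a (w, z) * (a (w \<otimes> z, y) * c) = a (z, y) * (a (w, z \<otimes> y) * c)" for c
      by (simp flip: mult.assoc)
    with True assms show ?thesis
      by (simp add: transl_def m_assoc)
  qed (simp add: transl_def)
qed

text \<open>This is where the symmetry of \<open>a\<close> enters: both composites are multiples of
  the translation by the same product, with the factors \<open>a (z, y)\<close> and
  \<open>a (y, z)\<close>.\<close>

lemma transl_commute: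
  assumes "z \<in> carrier K" and "y \<in> carrier K"
  shows "transl z (transl y v) = transl y (transl z v)"
  using assms by (simp add: transl_transl symmetric[of z y] m_comm[of z y])

lemma transl_pow_commute:
  assumes "z \<in> carrier K" and "y \<in> carrier K"
  shows "transl y ((transl z ^^ k) v) = (transl z ^^ k) (transl y v)"
  by (induction k) (simp_all add: transl_commute[OF assms(2,1)])

lemma transl_pow_scale: "(transl z ^^ k) (\<lambda>x. c * v x) = (\<lambda>x. c * (transl z ^^ k) v x)"
  by (induction k) (simp_all add: transl_scale)

text \<open>The cocycle identity at \<open>(x, 1, 1)\<close> gives
  \<open>a (x, 1) = a (1, 1)\<close>. Translation by the identity is therefore a scalar, but not 1
  unless \<open>a\<close> is normalized. The support condition is there because
  \<open>transl\<close> cuts off outside the group.\<close>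

lemma transl_one:
  assumes "\<And>x. x \<notin> carrier K \<Longrightarrow> v x = 0"
  shows "transl \<one> v = (\<lambda>x. a (\<one>, \<one>) * v x)"
proof
  fix x
  show "transl \<one> v x = a (\<one>, \<one>) * v x"
    using cocycle[of x \<one> \<one>] nonzero[of x \<one>] assms by (cases "x \<in> carrier K") (auto simp: transl_def)
qed

lemma transl_pow:
  assumes "z \<in> carrier K" and "\<And>x. x \<notin> carrier K \<Longrightarrow> v x = 0"
  shows "\<exists>c. c \<noteq> 0 \<and> (transl z ^^ k) v = (\<lambda>x. c * transl (z [^] k) v x)"
proof (induction k)
  case 0
  show ?case
    by (rule exI[of _ "1 / a (\<one>, \<one>)"]) (use nonzero in \<open>auto simp: transl_one[OF assms(2)]\<close>)
next
  case (Suc k)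
  then obtain c where "c \<noteq> 0" "(transl z ^^ k) v = (\<lambda>x. c * transl (z [^] k) v x)"
    by blast
  then show ?case
    using assms(1) nonzero[of z "z [^] k"]
    by (intro exI[of _ "c * a (z, z [^] k)"])
      (simp add: transl_scale transl_transl m_comm[of z] mult.assoc)
qed

text \<open>A power of a translation is a scalar times the translation by the power, and the power
  at the group order is the identity. This supplies the polynomial to which
  \<open>eigenvector_of_sequence\<close> is applied.\<close>

lemma transl_pow_order:
  assumes "z \<in> carrier K" and "\<And>x. x \<notin> carrier K \<Longrightarrow> v x = 0"
  shows "\<exists>c. c \<noteq> 0 \<and> (transl z ^^ Coset.order K) v = (\<lambda>x. c * v x)"
proof -
  obtain c where "c \<noteq> 0" "(transl z ^^ Coset.order K) v = (\<lambda>x. c * transl \<one> v x)"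
    using transl_pow[of z v "Coset.order K", OF assms] pow_order_eq_1[OF assms(1)] by auto
  then show ?thesis
    using nonzero[of \<one> \<one>] by (intro exI[of _ "c * a (\<one>, \<one>)"]) (simp add: transl_one[OF assms(2)] mult.assoc)
qed

lemma order_pos: "Coset.order K > 0"
  using finite_carrier order_gt_0_iff_finite by blast

text \<open>Elements are added one at a time; the new eigenvector is a polynomial in the new
  translation applied to the old one, so earlier eigenvalues survive. The set \<open>S0\<close>
  carries eigenvalues fixed in advance: it is empty for trivializing a cocycle and a singleton for
  separating points by characters.\<close>

lemma common_eigenvector:
  assumes "finite S" and "S \<subseteq> carrier K" and "S0 \<subseteq> carrier K"
    and v0: "\<exists>x. v0 x \<noteq> 0" "\<And>x. x \<notin> carrier K \<Longrightarrow> v0 x = 0" "\<forall>y\<in>S0. transl y v0 = (\<lambda>x. s y * v0 x)"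
  shows "\<exists>v. (\<exists>x. v x \<noteq> 0) \<and> (\<forall>x. x \<notin> carrier K \<longrightarrow> v x = 0) \<and>
    (\<forall>y\<in>S0. transl y v = (\<lambda>x. s y * v x)) \<and> (\<forall>y\<in>S. \<exists>l. transl y v = (\<lambda>x. l * v x))"
  using assms(1,2)
proof (induction S)
  case empty
  with v0 show ?case
    by (intro exI[of _ v0]) auto
next
  case (insert z S)
  then obtain v where v': "(\<exists>x. v x \<noteq> 0) \<and> (\<forall>x. x \<notin> carrier K \<longrightarrow> v x = 0) \<and>
    (\<forall>y\<in>S0. transl y v = (\<lambda>x. s y * v x)) \<and> (\<forall>y\<in>S. \<exists>l. transl y v = (\<lambda>x. l * v x))"
    by (elim exE meta_impE) simp_all
  then have v: "\<exists>x. v x \<noteq> 0" and supp: "\<And>x. x \<notin> carrier K \<Longrightarrow> v x = 0"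
    and ev0: "\<And>y. y \<in> S0 \<Longrightarrow> transl y v = (\<lambda>x. s y * v x)"
    and ev: "\<And>y. y \<in> S \<Longrightarrow> \<exists>l. transl y v = (\<lambda>x. l * v x)"
    by simp_all
  have z: "z \<in> carrier K"
    using insert.prems by simp
  obtain c where c: "c \<noteq> 0" "(transl z ^^ Coset.order K) v = (\<lambda>x. c * v x)"
    using transl_pow_order[of z v, OF z supp] by auto
  \<comment> \<open>\<open>X^n - c\<close>, with \<open>n\<close> the group order, annihilates the
    orbit of \<open>v\<close>. Positivity of \<open>n\<close> keeps its two terms apart.\<close>
  define p where "p = Polynomial.monom (1 :: complex) (Coset.order K) - [:c:]"
  have coeff_p: "Polynomial.coeff p k = (if k = Coset.order K then 1 else if k = 0 then - c else 0)" for k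
    using order_pos by (auto simp: p_def Polynomial.coeff_pCons split: nat.splits)
  have "Polynomial.coeff p (Coset.order K) \<noteq> 0"
    by (simp add: coeff_p)
  then have p0: "p \<noteq> 0" and deg: "Coset.order K \<le> Polynomial.degree p"
    by (auto intro: le_degree)
  have zero: "(\<Sum>k\<le>Polynomial.degree p. Polynomial.coeff p k * (transl z ^^ k) v x) = 0" for x
  proof -
    have "(\<Sum>k\<le>Polynomial.degree p. Polynomial.coeff p k * (transl z ^^ k) v x)
        = (\<Sum>k\<in>{0, Coset.order K}. Polynomial.coeff p k * (transl z ^^ k) v x)"
      by (intro sum.mono_neutral_right) (use deg in \<open>auto simp: coeff_p split: if_splits\<close>)
    also have "\<dots> = 0"
      using order_pos c by (simp add: coeff_p)
    finally show ?thesis .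
  qed
  obtain x0 where x0: "v x0 \<noteq> 0"
    using v by blast
  have base: "(transl z ^^ 0) v x0 \<noteq> 0"
    using x0 by simp
  obtain l q where "poly p l = 0"
    and q: "\<exists>x. (\<Sum>k\<le>Polynomial.degree q. Polynomial.coeff q k * (transl z ^^ k) v x) \<noteq> 0"
    and l: "\<And>x. (\<Sum>k\<le>Polynomial.degree q. Polynomial.coeff q k * (transl z ^^ Suc k) v x)
            = l * (\<Sum>k\<le>Polynomial.degree q. Polynomial.coeff q k * (transl z ^^ k) v x)"
    by (rule eigenvector_of_sequence[of p "\<lambda>k. (transl z ^^ k) v" x0, OF p0 base zero]) (rule that)
  define w where "w = (\<lambda>x. \<Sum>k\<le>Polynomial.degree q. Polynomial.coeff q k * (transl z ^^ k) v x)"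
  have transl_w: "transl y w = (\<lambda>x. m * w x)"
    if "y \<in> carrier K" "transl y v = (\<lambda>x. m * v x)" for y m
    unfolding w_def using that z
    by (simp add: transl_sum transl_pow_commute transl_pow_scale sum_distrib_left mult.left_commute)
  have "(transl z ^^ k) v x = 0" if "x \<notin> carrier K" for k x
    using that by (cases k) (auto simp: supp transl_def)
  then have "\<forall>x. x \<notin> carrier K \<longrightarrow> w x = 0"
    by (simp add: w_def)
  moreover have "transl z w = (\<lambda>x. l * w x)"
    using l by (simp add: w_def transl_sum)
  moreover have "\<forall>y\<in>S0. transl y w = (\<lambda>x. s y * w x)"
    using ev0 assms(3) transl_w by blast
  moreover have "\<forall>y\<in>S. \<exists>l. transl y w = (\<lambda>x. l * w x)"
    using ev insert.prems transl_w by (meson insert_subset subsetD)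
  ultimately show ?case
    using q by (intro exI[of _ w]) (auto simp: w_def)
qed

lemma ex_trivialization_eigenvalue:
  assumes "S0 \<subseteq> carrier K"
    and "\<exists>x. v0 x \<noteq> 0" "\<And>x. x \<notin> carrier K \<Longrightarrow> v0 x = 0" "\<forall>y\<in>S0. transl y v0 = (\<lambda>x. s0 y * v0 x)"
  obtains s where "\<And>z. z \<in> carrier K \<Longrightarrow> s z \<noteq> 0"
    and "\<And>z y. \<lbrakk>z \<in> carrier K; y \<in> carrier K\<rbrakk> \<Longrightarrow> s z * s y = a (z, y) * s (z \<otimes> y)"
    and "\<And>y. y \<in> S0 \<Longrightarrow> s y = s0 y"
proof -
  obtain v x0 where x0: "v x0 \<noteq> 0" and supp: "\<And>x. x \<notin> carrier K \<Longrightarrow> v x = 0"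
    and ev0: "\<And>y. y \<in> S0 \<Longrightarrow> transl y v = (\<lambda>x. s0 y * v x)"
    and "\<And>y. y \<in> carrier K \<Longrightarrow> \<exists>l. transl y v = (\<lambda>x. l * v x)"
    using common_eigenvector[OF finite_carrier subset_refl assms(1) assms(2-4)] by auto
  then obtain s where s: "\<And>y. y \<in> carrier K \<Longrightarrow> transl y v = (\<lambda>x. s y * v x)"
    by metis
  have x0K: "x0 \<in> carrier K"
    using x0 supp by blast
  show thesis
  proof (rule that[of s])
    show "s z * s y = a (z, y) * s (z \<otimes> y)" if zy: "z \<in> carrier K" "y \<in> carrier K" for z y
    proof -
      have "transl z (transl y v) = (\<lambda>x. s y * (s z * v x))"
        using zy by (simp only: s transl_scale)
      then have "s z * s y * v x0 = transl z (transl y v) x0"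
        by simp
      also have "transl z (transl y v) = (\<lambda>x. a (z, y) * (s (z \<otimes> y) * v x))"
        using zy by (simp only: transl_transl[OF zy] s[OF m_closed[OF zy]])
      finally show ?thesis
        using x0 by simp
    qed
    show "s z \<noteq> 0" if z: "z \<in> carrier K" for z
    proof
      assume "s z = 0"
      \<comment> \<open>At this point the translate equals a nonzero value of \<open>a\<close> times
        \<open>v x0\<close>.\<close>
      then have "transl z v (x0 \<otimes> inv z) = 0"
        using z by (simp add: s)
      then show False
        using z x0 x0K nonzero[of "x0 \<otimes> inv z" z] by (simp add: transl_def m_assoc)
    qed
    show "s y = s0 y" if "y \<in> S0" for y
      using fun_cong[OF ev0[OF that], of x0] fun_cong[OF s, of y x0] that assms(1) x0 by auto
  qed
qed

lemma ex_trivialization: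
  obtains s where "\<And>z. z \<in> carrier K \<Longrightarrow> s z \<noteq> 0"
    and "\<And>z y. \<lbrakk>z \<in> carrier K; y \<in> carrier K\<rbrakk> \<Longrightarrow> s z * s y = a (z, y) * s (z \<otimes> y)"
proof (rule ex_trivialization_eigenvalue[of "{}" "\<lambda>x. if x = \<one> then 1 else 0"])
  show "\<exists>x. (if x = \<one> then 1 else 0) \<noteq> (0 :: complex)"
    by (intro exI[of _ \<one>]) simp
qed (use that in auto)

end

text \<open>The character is found among the eigenvectors of translation by \<open>z0\<close> that lie in the image of
  \<open>1 - T\<close>: that image is annihilated by \<open>1 + T + \<dots> + T\<^sup>n\<^sup>-\<^sup>1\<close>, none of whose roots is \<open>1\<close>.\<close>

lemma (in comm_group) character_separates:
  assumes fin: "finite (carrier G)" and z0: "z0 \<in> carrier G" "z0 \<noteq> \<one>"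
  obtains s :: "'a \<Rightarrow> complex" where "\<And>z. z \<in> carrier G \<Longrightarrow> s z \<noteq> 0"
    and "\<And>z y. \<lbrakk>z \<in> carrier G; y \<in> carrier G\<rbrakk> \<Longrightarrow> s (z \<otimes> y) = s z * s y"
    and "s z0 \<noteq> 1"
proof -
  \<comment> \<open>With the constant cocycle the translations form the regular representation, and
    a trivialization is a homomorphism to the nonzero complex numbers.\<close>
  interpret C: symmetric_cocycle G "\<lambda>_. 1"
    by unfold_locales (use fin in auto)
  define d :: "'a \<Rightarrow> complex" where "d = (\<lambda>x. if x = \<one> then 1 else 0)"
  define e where "e = (\<lambda>x. d x - C.transl z0 d x)"
  define n where "n = Coset.order G"
  have n: "n > 0"
    using C.order_pos by (simp add: n_def)
  have transl_diff: "C.transl z0 (\<lambda>x. f x - g x) = (\<lambda>x. C.transl z0 f x - C.transl z0 g x)" for f g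
    by (auto simp: C.transl_def)
  have pow_e: "(C.transl z0 ^^ k) e = (\<lambda>x. (C.transl z0 ^^ k) d x - (C.transl z0 ^^ Suc k) d x)" for k
    by (induction k) (simp_all add: e_def transl_diff)
  have supp_d: "d x = 0" if "x \<notin> carrier G" for x
    using that by (auto simp: d_def)
  have pow_d: "(C.transl z0 ^^ k) d = C.transl (z0 [^] k) d" for k
  proof (induction k)
    case 0
    show ?case
      using C.transl_one[OF supp_d] by simp
  qed (use z0 in \<open>simp_all add: C.transl_transl m_comm[of z0]\<close>)
  have pow_n: "(C.transl z0 ^^ n) d = d"
    using C.transl_one[OF supp_d] z0 by (simp add: pow_d n_def pow_order_eq_1)
  define p where "p = (\<Sum>k<n. Polynomial.monom (1 :: complex) k)"
  have coeff_p: "Polynomial.coeff p k = (if k < n then 1 else 0)" for k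
    by (simp add: p_def Polynomial.coeff_sum)
  have p0: "p \<noteq> 0"
    using coeff_p[of 0] n by auto
  have p1: "poly p 1 = of_nat n"
    by (simp add: p_def Polynomial.poly_sum Polynomial.poly_monom)
  have zero: "(\<Sum>k\<le>Polynomial.degree p. Polynomial.coeff p k * (C.transl z0 ^^ k) e x) = 0" for x
  proof -
    have "(\<Sum>k\<le>Polynomial.degree p. Polynomial.coeff p k * (C.transl z0 ^^ k) e x)
        = (\<Sum>k<n. (C.transl z0 ^^ k) e x)"
    proof (intro sum.mono_neutral_cong_right)
      show "{..<n} \<subseteq> {..Polynomial.degree p}"
        using coeff_p by (auto intro!: le_degree)
    qed (auto simp: coeff_p)
    also have "\<dots> = (\<Sum>k<n. (C.transl z0 ^^ k) d x - (C.transl z0 ^^ Suc k) d x)"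
      by (simp only: pow_e)
    also have "\<dots> = d x - (C.transl z0 ^^ n) d x"
      by (subst sum_lessThan_telescope') simp
    finally show ?thesis
      by (simp add: pow_n)
  qed
  \<comment> \<open>The value is 1: the translate of \<open>d\<close> vanishes at the identity
    because \<open>z0\<close> differs from it.\<close>
  have e1: "(C.transl z0 ^^ 0) e \<one> \<noteq> 0"
    using z0 by (simp add: e_def C.transl_def d_def)
  obtain l q where pl: "poly p l = 0"
    and q: "\<exists>x. (\<Sum>k\<le>Polynomial.degree q. Polynomial.coeff q k * (C.transl z0 ^^ k) e x) \<noteq> 0"
    and l: "\<And>x. (\<Sum>k\<le>Polynomial.degree q. Polynomial.coeff q k * (C.transl z0 ^^ Suc k) e x)
            = l * (\<Sum>k\<le>Polynomial.degree q. Polynomial.coeff q k * (C.transl z0 ^^ k) e x)"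
    by (rule eigenvector_of_sequence[of p "\<lambda>k. (C.transl z0 ^^ k) e" \<one>, OF p0 e1 zero]) (rule that)
  define w where "w = (\<lambda>x. \<Sum>k\<le>Polynomial.degree q. Polynomial.coeff q k * (C.transl z0 ^^ k) e x)"
  have tw: "C.transl z0 w = (\<lambda>x. l * w x)"
    using l by (simp add: w_def C.transl_sum)
  have supp_e: "e x = 0" if "x \<notin> carrier G" for x
    using that by (simp add: e_def supp_d C.transl_def)
  have "(C.transl z0 ^^ k) e x = 0" if "x \<notin> carrier G" for k x
    using that by (cases k) (auto simp: supp_e C.transl_def)
  then have supp_w: "w x = 0" if "x \<notin> carrier G" for x
    using that by (simp add: w_def)
  have w0: "\<exists>x. w x \<noteq> 0"
    using q by (simp add: w_def)
  obtain s where "\<And>z. z \<in> carrier G \<Longrightarrow> s z \<noteq> 0"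
    and "\<And>z y. \<lbrakk>z \<in> carrier G; y \<in> carrier G\<rbrakk> \<Longrightarrow> s z * s y = 1 * s (z \<otimes> y)"
    and "\<And>y. y \<in> {z0} \<Longrightarrow> s y = l"
    by (rule C.ex_trivialization_eigenvalue[of "{z0}" w "\<lambda>_. l"])
      (use z0 w0 supp_w tw in auto)
  \<comment> \<open>The value of \<open>p\<close> at 1 is \<open>n\<close>, which is not
    zero.\<close>
  moreover have "l \<noteq> 1"
    using pl p1 n by auto
  ultimately show thesis
    by (intro that[of s]) auto
qed

subsection \<open>The second cohomology group\<close>

lemma carrier_complex_units [simp]: "carrier complex_units = - {0}"
proof -
  have "x \<in> Units (ring_of_type_algebra :: complex ring)" if "x \<noteq> 0" for x
    using that by (auto simp: Units_def ring_of_type_algebra_def intro!: exI[of _ "1 / x"])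
  then show ?thesis
    by (auto simp: units_of_def Units_def ring_of_type_algebra_def)
qed

lemma mult_complex_units [simp]: "x \<otimes>\<^bsub>complex_units\<^esub> y = x * y"
  by (simp add: units_of_def ring_of_type_algebra_def)

lemma one_complex_units [simp]: "\<one>\<^bsub>complex_units\<^esub> = 1"
  by (simp add: units_of_def ring_of_type_algebra_def)

lemma mult_cocycle_group [simp]:
  "\<alpha> \<otimes>\<^bsub>cocycle_group G\<^esub> \<beta> = (\<lambda>p\<in>carrier G \<times> carrier G. \<alpha> p * \<beta> p)"
  by (simp add: cocycle_group_def product_group_def)

lemma carrier_cocycle_group [simp]: "carrier (cocycle_group G) = cocycles G"
  by (simp add: cocycle_group_def)

lemma one_cocycle_group [simp]: "\<one>\<^bsub>cocycle_group G\<^esub> = (\<lambda>p\<in>carrier G \<times> carrier G. 1)"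
  by (simp add: cocycle_group_def product_group_def)

text \<open>Shaped for backward use: the cocycle identity of a pointwise product splits into the
  identities of the two factors.\<close>

lemma mult_mult_eq:
  fixes a b c d :: "'a :: comm_semiring_1"
  assumes "p * q = r * s" and "a * b = c * d"
  shows "p * a * (q * b) = r * c * (s * d)"
proof -
  have "p * a * (q * b) = p * q * (a * b)" "r * c * (s * d) = r * s * (c * d)"
    by (simp_all add: mult_ac)
  with assms show ?thesis
    by simp
qed

lemma cocycles_nonzero:
  "\<lbrakk>\<alpha> \<in> cocycles G; x \<in> carrier G; y \<in> carrier G\<rbrakk> \<Longrightarrow> \<alpha> (x, y) \<noteq> 0"
  unfolding cocycles_def by (auto dest: PiE_mem[where x = "(x, y)"])

lemma cocycles_identity:
  "\<lbrakk>\<alpha> \<in> cocycles G; x \<in> carrier G; y \<in> carrier G; z \<in> carrier G\<rbrakk>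
    \<Longrightarrow> \<alpha> (x, y) * \<alpha> (x \<otimes>\<^bsub>G\<^esub> y, z) = \<alpha> (y, z) * \<alpha> (x, y \<otimes>\<^bsub>G\<^esub> z)"
  unfolding cocycles_def by auto

lemma cocycles_eqI:
  assumes "\<alpha> \<in> cocycles G" and "\<beta> \<in> cocycles G"
    and "\<And>x y. \<lbrakk>x \<in> carrier G; y \<in> carrier G\<rbrakk> \<Longrightarrow> \<alpha> (x, y) = \<beta> (x, y)"
  shows "\<alpha> = \<beta>"
  using assms unfolding cocycles_def by (auto intro: PiE_ext)

context group
begin

lemma cocyclesI:
  assumes "\<And>x y. \<lbrakk>x \<in> carrier G; y \<in> carrier G\<rbrakk> \<Longrightarrow> f x y \<noteq> 0"
    and "\<And>x y z. \<lbrakk>x \<in> carrier G; y \<in> carrier G; z \<in> carrier G\<rbrakk>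
      \<Longrightarrow> f x y * f (x \<otimes> y) z = f y z * f x (y \<otimes> z)"
  shows "(\<lambda>(x, y)\<in>carrier G \<times> carrier G. f x y) \<in> cocycles G"
  using assms unfolding cocycles_def by auto

lemma cocyclesI':
  assumes "\<And>x y. \<lbrakk>x \<in> carrier G; y \<in> carrier G\<rbrakk> \<Longrightarrow> f (x, y) \<noteq> 0"
    and "\<And>x y z. \<lbrakk>x \<in> carrier G; y \<in> carrier G; z \<in> carrier G\<rbrakk>
      \<Longrightarrow> f (x, y) * f (x \<otimes> y, z) = f (y, z) * f (x, y \<otimes> z)"
  shows "(\<lambda>p\<in>carrier G \<times> carrier G. f p) \<in> cocycles G"
  using cocyclesI[of "\<lambda>x y. f (x, y)"] assms by (simp add: case_prod_unfold)

lemma cocycles_mult: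
  assumes "\<alpha> \<in> cocycles G" and "\<beta> \<in> cocycles G"
  shows "(\<lambda>p\<in>carrier G \<times> carrier G. \<alpha> p * \<beta> p) \<in> cocycles G"
proof (rule cocyclesI')
  fix x y z
  assume xyz: "x \<in> carrier G" "y \<in> carrier G" "z \<in> carrier G"
  show "\<alpha> (x, y) * \<beta> (x, y) * (\<alpha> (x \<otimes> y, z) * \<beta> (x \<otimes> y, z))
      = \<alpha> (y, z) * \<beta> (y, z) * (\<alpha> (x, y \<otimes> z) * \<beta> (x, y \<otimes> z))"
    by (intro mult_mult_eq cocycles_identity assms xyz)
qed (use assms in \<open>simp add: cocycles_nonzero\<close>)

lemma coboundary_identity:
  fixes f :: "'a \<Rightarrow> complex"
  assumes "x \<in> carrier G" "y \<in> carrier G" "z \<in> carrier G"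
    and "\<And>x. x \<in> carrier G \<Longrightarrow> f x \<noteq> 0"
  shows "f x * f y / f (x \<otimes> y) * (f (x \<otimes> y) * f z / f (x \<otimes> y \<otimes> z))
    = f y * f z / f (y \<otimes> z) * (f x * f (y \<otimes> z) / f (x \<otimes> (y \<otimes> z)))"
  using assms by (simp add: m_assoc field_simps)

lemma cocycles_mult_coboundary:
  assumes "\<alpha> \<in> cocycles G" and "\<And>x. x \<in> carrier G \<Longrightarrow> f x \<noteq> 0"
  shows "(\<lambda>(x, y)\<in>carrier G \<times> carrier G. f x * f y / f (x \<otimes> y) * \<alpha> (x, y)) \<in> cocycles G"
proof (rule cocyclesI)
  fix x y z
  assume xyz: "x \<in> carrier G" "y \<in> carrier G" "z \<in> carrier G"
  show "f x * f y / f (x \<otimes> y) * \<alpha> (x, y) * (f (x \<otimes> y) * f z / f (x \<otimes> y \<otimes> z) * \<alpha> (x \<otimes> y, z))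
    = f y * f z / f (y \<otimes> z) * \<alpha> (y, z) * (f x * f (y \<otimes> z) / f (x \<otimes> (y \<otimes> z)) * \<alpha> (x, y \<otimes> z))"
    by (intro mult_mult_eq cocycles_identity coboundary_identity assms xyz)
qed (use assms in \<open>simp add: cocycles_nonzero\<close>)

lemma one_cocycles: "(\<lambda>p\<in>carrier G \<times> carrier G. 1) \<in> cocycles G"
  by (rule cocyclesI') auto

lemma cocycles_inverse:
  assumes "\<alpha> \<in> cocycles G"
  shows "(\<lambda>p\<in>carrier G \<times> carrier G. inverse (\<alpha> p)) \<in> cocycles G"
proof (rule cocyclesI')
  fix x y z
  assume xyz: "x \<in> carrier G" "y \<in> carrier G" "z \<in> carrier G"
  show "inverse (\<alpha> (x, y)) * inverse (\<alpha> (x \<otimes> y, z)) = inverse (\<alpha> (y, z)) * inverse (\<alpha> (x, y \<otimes> z))"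
    using cocycles_identity[OF assms(1) xyz] by (simp flip: inverse_mult_distrib)
qed (use assms in \<open>simp add: cocycles_nonzero\<close>)

lemma comm_group_cocycle_group: "comm_group (cocycle_group G)"
proof (rule comm_groupI)
  fix \<alpha> assume \<alpha>: "\<alpha> \<in> carrier (cocycle_group G)"
  then show "\<exists>\<beta>\<in>carrier (cocycle_group G). \<beta> \<otimes>\<^bsub>cocycle_group G\<^esub> \<alpha> = \<one>\<^bsub>cocycle_group G\<^esub>"
    by (intro bexI[of _ "\<lambda>p\<in>carrier G \<times> carrier G. inverse (\<alpha> p)"])
      (auto simp: cocycles_inverse cocycles_nonzero)
  show "\<one>\<^bsub>cocycle_group G\<^esub> \<otimes>\<^bsub>cocycle_group G\<^esub> \<alpha> = \<alpha>"
    using \<alpha> cocycles_mult[OF one_cocycles, of \<alpha>] by (intro cocycles_eqI) auto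
qed (auto simp: cocycles_mult one_cocycles mult_ac)

lemma mem_coboundaries_iff:
  "\<beta> \<in> coboundaries G \<longleftrightarrow> (\<exists>f. (\<forall>x\<in>carrier G. f x \<noteq> 0) \<and>
    \<beta> = (\<lambda>(x, y)\<in>carrier G \<times> carrier G. f x * f y / f (x \<otimes> y)))"
  by (auto simp: coboundaries_def Pi_def)

lemma coboundaries_subset: "coboundaries G \<subseteq> cocycles G"
proof
  fix \<beta> assume "\<beta> \<in> coboundaries G"
  then obtain f where f: "\<And>x. x \<in> carrier G \<Longrightarrow> f x \<noteq> 0"
    and \<beta>: "\<beta> = (\<lambda>(x, y)\<in>carrier G \<times> carrier G. f x * f y / f (x \<otimes> y))"
    unfolding mem_coboundaries_iff by blast
  show "\<beta> \<in> cocycles G"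
    unfolding \<beta> by (intro cocyclesI coboundary_identity) (use f in auto)
qed

lemma normal_coboundaries: "normal (coboundaries G) (cocycle_group G)"
proof -
  interpret C: comm_group "cocycle_group G"
    by (rule comm_group_cocycle_group)
  have "subgroup (coboundaries G) (cocycle_group G)"
  proof (rule C.subgroupI)
    show "coboundaries G \<noteq> {}"
      using mem_coboundaries_iff[THEN iffD2, OF exI[of _ "\<lambda>_. 1"]] by auto
  next
    fix \<beta> assume "\<beta> \<in> coboundaries G"
    then obtain f where f: "\<And>x. x \<in> carrier G \<Longrightarrow> f x \<noteq> 0"
      and \<beta>: "\<beta> = (\<lambda>(x, y)\<in>carrier G \<times> carrier G. f x * f y / f (x \<otimes> y))"
      unfolding mem_coboundaries_iff by blast
    define \<gamma> where "\<gamma> = (\<lambda>(x, y)\<in>carrier G \<times> carrier G.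
      inverse (f x) * inverse (f y) / inverse (f (x \<otimes> y)))"
    have \<gamma>: "\<gamma> \<in> coboundaries G"
      unfolding mem_coboundaries_iff \<gamma>_def using f by (intro exI[of _ "\<lambda>x. inverse (f x)"]) auto
    have "inv\<^bsub>cocycle_group G\<^esub> \<beta> = \<gamma>"
    proof (rule C.inv_equality)
      show "\<gamma> \<otimes>\<^bsub>cocycle_group G\<^esub> \<beta> = \<one>\<^bsub>cocycle_group G\<^esub>"
        using f by (auto simp: \<beta> \<gamma>_def fun_eq_iff field_simps)
    qed (use \<gamma> coboundaries_subset \<open>\<beta> \<in> coboundaries G\<close> in auto)
    with \<gamma> show "inv\<^bsub>cocycle_group G\<^esub> \<beta> \<in> coboundaries G"
      by simp
  next
    fix \<beta> \<gamma> assume "\<beta> \<in> coboundaries G" "\<gamma> \<in> coboundaries G"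
    then obtain f g where "\<And>x. x \<in> carrier G \<Longrightarrow> f x \<noteq> 0" "\<And>x. x \<in> carrier G \<Longrightarrow> g x \<noteq> 0"
      and "\<beta> = (\<lambda>(x, y)\<in>carrier G \<times> carrier G. f x * f y / f (x \<otimes> y))"
      and "\<gamma> = (\<lambda>(x, y)\<in>carrier G \<times> carrier G. g x * g y / g (x \<otimes> y))"
      unfolding mem_coboundaries_iff by blast
    then show "\<beta> \<otimes>\<^bsub>cocycle_group G\<^esub> \<gamma> \<in> coboundaries G"
      unfolding mem_coboundaries_iff
      by (intro exI[of _ "\<lambda>x. f x * g x"]) (auto simp: fun_eq_iff field_simps)
  qed (use coboundaries_subset in simp)
  then show ?thesis
    by (simp add: C.normal_iff_subgroup)
qed

text \<open>Trades the coset for a pointwise equation. The conjunct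
  \<open>\<beta> \<in> cocycles G\<close> carries the extensionality, so that the values on the
  group determine \<beta>.\<close>

lemma cohomology_class_iff:
  assumes "\<alpha> \<in> cocycles G"
  shows "\<beta> \<in> cohomology_class G \<alpha> \<longleftrightarrow> \<beta> \<in> cocycles G \<and>
    (\<exists>f. (\<forall>x\<in>carrier G. f x \<noteq> 0) \<and>
      (\<forall>x\<in>carrier G. \<forall>y\<in>carrier G. \<beta> (x, y) = f x * f y / f (x \<otimes> y) * \<alpha> (x, y)))"
    (is "?L \<longleftrightarrow> ?R")
proof -
  have "?L \<longleftrightarrow> (\<exists>f. (\<forall>x\<in>carrier G. f x \<noteq> 0) \<and>
      \<beta> = (\<lambda>(x, y)\<in>carrier G \<times> carrier G. f x * f y / f (x \<otimes> y) * \<alpha> (x, y)))"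
  proof -
    have eq: "(\<lambda>p\<in>carrier G \<times> carrier G. (\<lambda>(x, y)\<in>carrier G \<times> carrier G. f x * f y / f (x \<otimes> y)) p * \<alpha> p)
      = (\<lambda>(x, y)\<in>carrier G \<times> carrier G. f x * f y / f (x \<otimes> y) * \<alpha> (x, y))" for f
      by auto
    have "?L \<longleftrightarrow> (\<exists>\<gamma>\<in>coboundaries G. \<beta> = (\<lambda>p\<in>carrier G \<times> carrier G. \<gamma> p * \<alpha> p))"
      unfolding cohomology_class_def r_coset_def mult_cocycle_group by blast
    also have "\<dots> \<longleftrightarrow> (\<exists>f. (\<forall>x\<in>carrier G. f x \<noteq> 0) \<and> \<beta> = (\<lambda>p\<in>carrier G \<times> carrier G.
        (\<lambda>(x, y)\<in>carrier G \<times> carrier G. f x * f y / f (x \<otimes> y)) p * \<alpha> p))"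
      unfolding Bex_def mem_coboundaries_iff by blast
    finally show ?thesis
      by (simp only: eq)
  qed
  also have "\<dots> \<longleftrightarrow> ?R"
  proof
    assume "\<exists>f. (\<forall>x\<in>carrier G. f x \<noteq> 0) \<and>
      \<beta> = (\<lambda>(x, y)\<in>carrier G \<times> carrier G. f x * f y / f (x \<otimes> y) * \<alpha> (x, y))"
    with assms show ?R
      using cocycles_mult_coboundary by fastforce
  next
    assume ?R
    then obtain f where f: "\<forall>x\<in>carrier G. f x \<noteq> 0"
      and \<beta>: "\<beta> \<in> cocycles G" "\<forall>x\<in>carrier G. \<forall>y\<in>carrier G. \<beta> (x, y) = f x * f y / f (x \<otimes> y) * \<alpha> (x, y)"
      by blast
    then have "\<beta> = (\<lambda>(x, y)\<in>carrier G \<times> carrier G. f x * f y / f (x \<otimes> y) * \<alpha> (x, y))"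
      using assms by (intro cocycles_eqI[OF \<beta>(1)] cocycles_mult_coboundary) auto
    with f show "\<exists>f. (\<forall>x\<in>carrier G. f x \<noteq> 0) \<and>
      \<beta> = (\<lambda>(x, y)\<in>carrier G \<times> carrier G. f x * f y / f (x \<otimes> y) * \<alpha> (x, y))"
      by blast
  qed
  finally show ?thesis .
qed

lemma cohomology_class_eq_iff:
  assumes "\<alpha> \<in> cocycles G" and "\<beta> \<in> cocycles G"
  shows "cohomology_class G \<alpha> = cohomology_class G \<beta> \<longleftrightarrow> \<beta> \<in> cohomology_class G \<alpha>"
proof -
  interpret N: normal "coboundaries G" "cocycle_group G"
    by (rule normal_coboundaries)
  show ?thesis
    using assms N.rcos_self[of \<beta>] N.repr_independence[of \<beta> "coboundaries G" \<alpha>] N.subgroup_axioms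
    unfolding cohomology_class_def by auto
qed

lemma cohomology_class_self: "\<alpha> \<in> cocycles G \<Longrightarrow> \<alpha> \<in> cohomology_class G \<alpha>"
  using cohomology_class_eq_iff by blast

lemma cohomology_class_eqI:
  assumes "\<alpha> \<in> cocycles G" and "\<beta> \<in> cocycles G"
    and "\<And>x. x \<in> carrier G \<Longrightarrow> f x \<noteq> 0"
    and "\<And>x y. \<lbrakk>x \<in> carrier G; y \<in> carrier G\<rbrakk> \<Longrightarrow> \<beta> (x, y) = f x * f y / f (x \<otimes> y) * \<alpha> (x, y)"
  shows "cohomology_class G \<alpha> = cohomology_class G \<beta>"
  using assms by (auto simp: cohomology_class_eq_iff cohomology_class_iff)

lemma group_second_cohomology: "group (second_cohomology G)"
  unfolding second_cohomology_def using normal_coboundaries by (rule normal.factorgroup_is_group)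

lemma carrier_second_cohomology: "carrier (second_cohomology G) = cohomology_class G ` cocycles G"
  unfolding second_cohomology_def carrier_FactGroup cohomology_class_def by simp

lemma second_cohomology_mult:
  assumes "\<alpha> \<in> cocycles G" and "\<beta> \<in> cocycles G"
  shows "cohomology_class G \<alpha> \<otimes>\<^bsub>second_cohomology G\<^esub> cohomology_class G \<beta>
    = cohomology_class G (\<lambda>p\<in>carrier G \<times> carrier G. \<alpha> p * \<beta> p)"
proof -
  interpret N: normal "coboundaries G" "cocycle_group G"
    by (rule normal_coboundaries)
  show ?thesis
    using assms N.rcos_sum[of \<alpha> \<beta>] by (simp add: second_cohomology_def cohomology_class_def)
qed

lemma second_cohomology_one:
  "\<one>\<^bsub>second_cohomology G\<^esub> = cohomology_class G (\<lambda>p\<in>carrier G \<times> carrier G. 1)"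
proof -
  interpret N: normal "coboundaries G" "cocycle_group G"
    by (rule normal_coboundaries)
  show ?thesis
    using N.coset_mult_one[of "coboundaries G"] coboundaries_subset
    by (simp add: second_cohomology_def cohomology_class_def)
qed

end

subsection \<open>Characters of finite abelian groups\<close>

context comm_group
begin

definition chars :: "('a \<Rightarrow> complex) set" where
  "chars = hom G complex_units \<inter> extensional (carrier G)"

lemma charsI:
  assumes "\<And>z. z \<in> carrier G \<Longrightarrow> s z \<noteq> 0"
    and "\<And>z w. \<lbrakk>z \<in> carrier G; w \<in> carrier G\<rbrakk> \<Longrightarrow> s (z \<otimes> w) = s z * s w"
  shows "(\<lambda>z\<in>carrier G. s z) \<in> chars"
  using assms by (auto simp: chars_def hom_def)

lemma chars_nonzero: "\<lbrakk>\<chi> \<in> chars; z \<in> carrier G\<rbrakk> \<Longrightarrow> \<chi> z \<noteq> 0"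
  by (auto simp: chars_def hom_def)

lemma chars_mult: "\<lbrakk>\<chi> \<in> chars; z \<in> carrier G; w \<in> carrier G\<rbrakk> \<Longrightarrow> \<chi> (z \<otimes> w) = \<chi> z * \<chi> w"
  by (auto simp: chars_def hom_def)

lemma chars_one: "\<chi> \<in> chars \<Longrightarrow> \<chi> \<one> = 1"
  using chars_mult[of \<chi> \<one> \<one>] chars_nonzero[of \<chi> \<one>] by simp

lemma chars_inv: "\<lbrakk>\<chi> \<in> chars; z \<in> carrier G\<rbrakk> \<Longrightarrow> \<chi> (inv z) = inverse (\<chi> z)"
  using chars_mult[of \<chi> z "inv z"] chars_one[of \<chi>] by (simp add: inverse_unique)

lemma chars_pow: "\<lbrakk>\<chi> \<in> chars; z \<in> carrier G\<rbrakk> \<Longrightarrow> \<chi> (z [^] (n :: nat)) = \<chi> z ^ n"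
  by (induction n) (simp_all add: chars_one chars_mult)

lemma chars_times:
  assumes "\<chi> \<in> chars" and "\<psi> \<in> chars"
  shows "(\<lambda>z\<in>carrier G. \<chi> z * \<psi> z) \<in> chars"
  using assms by (intro charsI) (simp_all add: chars_nonzero chars_mult)

lemma chars_divide:
  assumes "\<chi> \<in> chars" and "\<psi> \<in> chars"
  shows "(\<lambda>z\<in>carrier G. \<chi> z / \<psi> z) \<in> chars"
  using assms by (intro charsI) (simp_all add: chars_nonzero chars_mult)

lemma chars_eqI:
  assumes "\<chi> \<in> chars" and "\<psi> \<in> chars" and "\<And>z. z \<in> carrier G \<Longrightarrow> \<chi> z = \<psi> z"
  shows "\<chi> = \<psi>"
  using assms by (auto simp: chars_def intro: extensionalityI)

lemma one_chars: "(\<lambda>z\<in>carrier G. 1) \<in> chars"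
  by (rule charsI) simp_all

text \<open>Values of characters are roots of unity of degree the group order, which leaves finitely
  many functions.\<close>

lemma finite_chars:
  assumes fin: "finite (carrier G)"
  shows "finite chars"
proof -
  have n: "Coset.order G > 0"
    using fin order_gt_0_iff_finite by blast
  have "\<chi> z ^ Coset.order G = 1" if "\<chi> \<in> chars" "z \<in> carrier G" for \<chi> z
    using that by (simp add: pow_order_eq_1 chars_one flip: chars_pow)
  then have "chars \<subseteq> carrier G \<rightarrow>\<^sub>E {x. x ^ Coset.order G = 1}"
    by (auto simp: chars_def PiE_def)
  moreover have "finite (carrier G \<rightarrow>\<^sub>E {x :: complex. x ^ Coset.order G = 1})"
    using n fin by (intro finite_PiE finite_nth_roots) auto
  ultimately show ?thesis
    by (rule finite_subset)
qed

text \<open>Shifting the summation variable by \<open>w\<close> multiplies the sum by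
  \<open>\<chi> w\<close>.\<close>

lemma sum_char_nontrivial:
  assumes fin: "finite (carrier G)" and \<chi>: "\<chi> \<in> chars" and w: "w \<in> carrier G" "\<chi> w \<noteq> 1"
  shows "(\<Sum>z\<in>carrier G. \<chi> z) = 0"
proof -
  have "(\<Sum>z\<in>carrier G. \<chi> z) = (\<Sum>z\<in>carrier G. \<chi> (w \<otimes> z))"
    by (rule sum.reindex_bij_witness[of _ "\<lambda>z. w \<otimes> z" "\<lambda>z. inv w \<otimes> z"])
      (use w in \<open>simp_all flip: m_assoc\<close>)
  also have "\<dots> = \<chi> w * (\<Sum>z\<in>carrier G. \<chi> z)"
    using \<chi> w by (simp add: chars_mult sum_distrib_left)
  finally show ?thesis
    using w by simp
qed

text \<open>Dual to the preceding sum: multiplication by a character that is not 1 at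
  \<open>w\<close> permutes the characters and rescales the sum. Such a character comes from
  \<open>character_separates\<close>.\<close>

lemma sum_chars_nontrivial:
  assumes fin: "finite (carrier G)" and w: "w \<in> carrier G" "w \<noteq> \<one>"
  shows "(\<Sum>\<chi>\<in>chars. \<chi> w) = 0"
proof -
  obtain s :: "'a \<Rightarrow> complex" where s: "\<And>z. z \<in> carrier G \<Longrightarrow> s z \<noteq> 0"
    "\<And>z y. \<lbrakk>z \<in> carrier G; y \<in> carrier G\<rbrakk> \<Longrightarrow> s (z \<otimes> y) = s z * s y" and sw: "s w \<noteq> 1"
    using fin w by (rule character_separates) (rule that)
  define \<psi> where "\<psi> = (\<lambda>z\<in>carrier G. s z)"
  have \<psi>: "\<psi> \<in> chars"
    unfolding \<psi>_def using s by (rule charsI)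
  have "(\<Sum>\<chi>\<in>chars. \<chi> w) = (\<Sum>\<chi>\<in>chars. (\<lambda>z\<in>carrier G. \<psi> z * \<chi> z) w)"
  proof (rule sum.reindex_bij_witness[of _ "\<lambda>\<chi>. \<lambda>z\<in>carrier G. \<psi> z * \<chi> z" "\<lambda>\<chi>. \<lambda>z\<in>carrier G. \<chi> z / \<psi> z"])
    fix \<chi> assume \<chi>: "\<chi> \<in> chars"
    show 1: "(\<lambda>z\<in>carrier G. \<chi> z / \<psi> z) \<in> chars" and 2: "(\<lambda>z\<in>carrier G. \<psi> z * \<chi> z) \<in> chars"
      by (rule chars_divide[OF \<chi> \<psi>], rule chars_times[OF \<psi> \<chi>])
    show "(\<lambda>z\<in>carrier G. \<psi> z * (\<lambda>z\<in>carrier G. \<chi> z / \<psi> z) z) = \<chi>"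
      by (rule chars_eqI[OF chars_times[OF \<psi> 1] \<chi>]) (use \<psi> in \<open>simp add: chars_nonzero\<close>)
    show "(\<lambda>z\<in>carrier G. (\<lambda>z\<in>carrier G. \<psi> z * \<chi> z) z / \<psi> z) = \<chi>"
      by (rule chars_eqI[OF chars_divide[OF 2 \<psi>] \<chi>]) (use \<psi> in \<open>simp add: chars_nonzero\<close>)
    show "(\<lambda>z\<in>carrier G. \<psi> z * (\<lambda>z\<in>carrier G. \<chi> z / \<psi> z) z) w = \<chi> w"
      using w \<psi> by (simp add: chars_nonzero)
  qed
  also have "\<dots> = \<psi> w * (\<Sum>\<chi>\<in>chars. \<chi> w)"
    using w by (simp add: sum_distrib_left)
  finally show ?thesis
    using sw w by (simp add: \<psi>_def)
qed

text \<open>The sum of all \<open>\<chi> z\<close> is computed in two ways: by rows only the trivial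
  character contributes, by columns only the identity element.\<close>

lemma card_chars:
  assumes fin: "finite (carrier G)"
  shows "card chars = card (carrier G)"
proof -
  have "(\<Sum>z\<in>carrier G. \<chi> z) = (if \<chi> = (\<lambda>z\<in>carrier G. 1) then of_nat (card (carrier G)) else 0)"
    if \<chi>: "\<chi> \<in> chars" for \<chi>
  proof (cases "\<forall>w\<in>carrier G. \<chi> w = 1")
    case True
    then have "\<chi> = (\<lambda>z\<in>carrier G. 1)"
      using \<chi> by (intro chars_eqI one_chars) auto
    then show ?thesis
      by simp
  next
    case False
    then show ?thesis
      using sum_char_nontrivial[OF fin \<chi>] by auto
  qed
  then have "(\<Sum>\<chi>\<in>chars. \<Sum>z\<in>carrier G. \<chi> z) = of_nat (card (carrier G))"
    using one_chars finite_chars[OF fin] by simp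
  moreover have "(\<Sum>\<chi>\<in>chars. \<chi> z) = (if z = \<one> then of_nat (card chars) else 0)"
    if "z \<in> carrier G" for z
    using that sum_chars_nontrivial[OF fin that] by (auto simp: chars_one)
  then have "(\<Sum>z\<in>carrier G. \<Sum>\<chi>\<in>chars. \<chi> z) = of_nat (card chars)"
    using fin by simp
  ultimately have "(of_nat (card chars) :: complex) = of_nat (card (carrier G))"
    by (simp add: sum.swap[of _ chars])
  then show ?thesis
    by simp
qed

text \<open>Quotients stand in for complex conjugates: \<open>\<chi> / \<psi>\<close> is again a
  character, and a nontrivial one when the two differ.\<close>

lemma orthogonality_carrier:
  assumes fin: "finite (carrier G)" and \<chi>: "\<chi> \<in> chars" and \<psi>: "\<psi> \<in> chars"
  shows "(\<Sum>z\<in>carrier G. \<chi> z / \<psi> z) = (if \<chi> = \<psi> then of_nat (card (carrier G)) else 0)"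
proof (cases "\<chi> = \<psi>")
  case True
  then show ?thesis
    using \<psi> by (simp add: chars_nonzero)
next
  case False
  then obtain w where w: "w \<in> carrier G" "\<chi> w \<noteq> \<psi> w"
    using chars_eqI[OF \<chi> \<psi>] by blast
  then have "(\<lambda>z\<in>carrier G. \<chi> z / \<psi> z) w \<noteq> 1"
    using \<psi> by (simp add: chars_nonzero)
  then have "(\<Sum>z\<in>carrier G. (\<lambda>z\<in>carrier G. \<chi> z / \<psi> z) z) = 0"
    using fin w(1) chars_divide[OF \<chi> \<psi>] by (intro sum_char_nontrivial)
  with False show ?thesis
    by simp
qed

text \<open>Off the diagonal this is the sum over characters at \<open>z \<otimes> inv w\<close>.
  The diagonal value counts the characters, hence the appeal to \<open>card_chars\<close>.\<close>

lemma orthogonality_chars: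
  assumes fin: "finite (carrier G)" and zw: "z \<in> carrier G" "w \<in> carrier G"
  shows "(\<Sum>\<chi>\<in>chars. \<chi> z / \<chi> w) = (if z = w then of_nat (card (carrier G)) else 0)"
proof (cases "z = w")
  case True
  have "(\<Sum>\<chi>\<in>chars. \<chi> z / \<chi> w) = (\<Sum>\<chi>\<in>chars. 1)"
    using True zw by (intro sum.cong refl) (simp add: chars_nonzero)
  then show ?thesis
    using True by (simp add: card_chars[OF fin])
next
  case False
  then have "z \<otimes> inv w \<noteq> \<one>"
    using zw by (metis inv_closed inv_equality inv_inv)
  then have "(\<Sum>\<chi>\<in>chars. \<chi> (z \<otimes> inv w)) = 0"
    using fin zw by (intro sum_chars_nontrivial) simp_all
  with False zw show ?thesis
    by (simp add: chars_mult chars_inv divide_inverse)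
qed

end

subsection \<open>Isomorphisms of twisted group algebras\<close>

lemma algebra_isomorphicI:
  assumes "bij_betw f (carrier A) (carrier B)"
    and "\<And>x y. \<lbrakk>x \<in> carrier A; y \<in> carrier A\<rbrakk> \<Longrightarrow> f (x \<otimes>\<^bsub>A\<^esub> y) = f x \<otimes>\<^bsub>B\<^esub> f y"
    and "\<And>x y. \<lbrakk>x \<in> carrier A; y \<in> carrier A\<rbrakk> \<Longrightarrow> f (x \<oplus>\<^bsub>A\<^esub> y) = f x \<oplus>\<^bsub>B\<^esub> f y"
    and "f \<one>\<^bsub>A\<^esub> = \<one>\<^bsub>B\<^esub>"
    and "\<And>c x. x \<in> carrier A \<Longrightarrow> f (c \<odot>\<^bsub>A\<^esub> x) = c \<odot>\<^bsub>B\<^esub> f x"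
  shows "algebra_isomorphic A B"
proof -
  have "f \<in> ring_hom A B"
    using assms by (intro ring_hom_memI) (auto dest: bij_betwE)
  with assms show ?thesis
    unfolding algebra_isomorphic_def ring_iso_def by blast
qed

lemma algebra_isomorphicE:
  assumes "algebra_isomorphic A B"
  obtains f where "bij_betw f (carrier A) (carrier B)"
    and "\<And>x y. \<lbrakk>x \<in> carrier A; y \<in> carrier A\<rbrakk> \<Longrightarrow> f (x \<otimes>\<^bsub>A\<^esub> y) = f x \<otimes>\<^bsub>B\<^esub> f y"
    and "\<And>x y. \<lbrakk>x \<in> carrier A; y \<in> carrier A\<rbrakk> \<Longrightarrow> f (x \<oplus>\<^bsub>A\<^esub> y) = f x \<oplus>\<^bsub>B\<^esub> f y"
    and "f \<one>\<^bsub>A\<^esub> = \<one>\<^bsub>B\<^esub>"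
    and "\<And>c x. x \<in> carrier A \<Longrightarrow> f (c \<odot>\<^bsub>A\<^esub> x) = c \<odot>\<^bsub>B\<^esub> f x"
  using assms that unfolding algebra_isomorphic_def ring_iso_def
  by (auto simp: ring_hom_mult ring_hom_add ring_hom_one)

lemma algebra_isomorphic_trans:
  assumes "algebra_isomorphic A B" and "algebra_isomorphic B C"
  shows "algebra_isomorphic A C"
proof -
  obtain f where f: "bij_betw f (carrier A) (carrier B)"
    "\<And>x y. \<lbrakk>x \<in> carrier A; y \<in> carrier A\<rbrakk> \<Longrightarrow> f (x \<otimes>\<^bsub>A\<^esub> y) = f x \<otimes>\<^bsub>B\<^esub> f y"
    "\<And>x y. \<lbrakk>x \<in> carrier A; y \<in> carrier A\<rbrakk> \<Longrightarrow> f (x \<oplus>\<^bsub>A\<^esub> y) = f x \<oplus>\<^bsub>B\<^esub> f y"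
    "f \<one>\<^bsub>A\<^esub> = \<one>\<^bsub>B\<^esub>"
    "\<And>c x. x \<in> carrier A \<Longrightarrow> f (c \<odot>\<^bsub>A\<^esub> x) = c \<odot>\<^bsub>B\<^esub> f x"
    using assms(1) by (rule algebra_isomorphicE) (rule that)
  obtain g where g: "bij_betw g (carrier B) (carrier C)"
    "\<And>x y. \<lbrakk>x \<in> carrier B; y \<in> carrier B\<rbrakk> \<Longrightarrow> g (x \<otimes>\<^bsub>B\<^esub> y) = g x \<otimes>\<^bsub>C\<^esub> g y"
    "\<And>x y. \<lbrakk>x \<in> carrier B; y \<in> carrier B\<rbrakk> \<Longrightarrow> g (x \<oplus>\<^bsub>B\<^esub> y) = g x \<oplus>\<^bsub>C\<^esub> g y"
    "g \<one>\<^bsub>B\<^esub> = \<one>\<^bsub>C\<^esub>"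
    "\<And>c x. x \<in> carrier B \<Longrightarrow> g (c \<odot>\<^bsub>B\<^esub> x) = c \<odot>\<^bsub>C\<^esub> g x"
    using assms(2) by (rule algebra_isomorphicE) (rule that)
  have fB: "f x \<in> carrier B" if "x \<in> carrier A" for x
    using f(1) that by (auto dest: bij_betwE)
  show ?thesis
    by (rule algebra_isomorphicI[of "g \<circ> f"])
      (use f g in \<open>auto simp: fB intro: bij_betw_trans\<close>)
qed

text \<open>The inverse map respects the operations once the source is closed under them. For a
  twisted group algebra closure is built in, since every operation returns a function restricted to
  the group.\<close>

lemma algebra_isomorphic_twisted_sym:
  assumes "algebra_isomorphic (twisted_group_algebra G \<alpha>) B"
  shows "algebra_isomorphic B (twisted_group_algebra G \<alpha>)"
proof -
  let ?A = "twisted_group_algebra G \<alpha>"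
  obtain f where f: "bij_betw f (carrier ?A) (carrier B)"
    and mult: "\<And>x y. \<lbrakk>x \<in> carrier ?A; y \<in> carrier ?A\<rbrakk> \<Longrightarrow> f (x \<otimes>\<^bsub>?A\<^esub> y) = f x \<otimes>\<^bsub>B\<^esub> f y"
    and add: "\<And>x y. \<lbrakk>x \<in> carrier ?A; y \<in> carrier ?A\<rbrakk> \<Longrightarrow> f (x \<oplus>\<^bsub>?A\<^esub> y) = f x \<oplus>\<^bsub>B\<^esub> f y"
    and one: "f \<one>\<^bsub>?A\<^esub> = \<one>\<^bsub>B\<^esub>"
    and smult: "\<And>c x. x \<in> carrier ?A \<Longrightarrow> f (c \<odot>\<^bsub>?A\<^esub> x) = c \<odot>\<^bsub>B\<^esub> f x"
    using assms by (rule algebra_isomorphicE) (rule that)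
  define g where "g = inv_into (carrier ?A) f"
  have g: "bij_betw g (carrier B) (carrier ?A)"
    unfolding g_def using f by (rule bij_betw_inv_into)
  have gA: "g x \<in> carrier ?A" and fg: "f (g x) = x" if "x \<in> carrier B" for x
    using g f that by (auto simp: g_def bij_betw_inv_into_right dest: bij_betwE)
  have gI: "g y = x" if "x \<in> carrier ?A" "y = f x" for x y
    using f that by (simp add: g_def bij_betw_inv_into_left)
  have closed: "x \<otimes>\<^bsub>?A\<^esub> y \<in> carrier ?A" "x \<oplus>\<^bsub>?A\<^esub> y \<in> carrier ?A" "\<one>\<^bsub>?A\<^esub> \<in> carrier ?A"
    "c \<odot>\<^bsub>?A\<^esub> x \<in> carrier ?A" for c x y
    by (simp_all add: twisted_group_algebra_def)
  show ?thesis
    by (rule algebra_isomorphicI[OF g])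
      (auto intro!: gI closed simp: mult add one smult gA fg)
qed

section \<open>Products of algebras\<close>

definition product_algebra ::
    "'i set \<Rightarrow> ('i \<Rightarrow> (complex, 'a, 'm) module_scheme) \<Rightarrow> (complex, 'i \<Rightarrow> 'a) module" where
  "product_algebra I A =
     \<lparr>carrier = (\<Pi>\<^sub>E i\<in>I. carrier (A i)),
      monoid.mult = (\<lambda>a b. \<lambda>i\<in>I. a i \<otimes>\<^bsub>A i\<^esub> b i),
      one = (\<lambda>i\<in>I. \<one>\<^bsub>A i\<^esub>),
      ring.zero = (\<lambda>i\<in>I. \<zero>\<^bsub>A i\<^esub>),
      add = (\<lambda>a b. \<lambda>i\<in>I. a i \<oplus>\<^bsub>A i\<^esub> b i),
      module.smult = (\<lambda>c a. \<lambda>i\<in>I. c \<odot>\<^bsub>A i\<^esub> a i)\<rparr>"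

lemma algebra_isomorphic_product:
  assumes j: "bij_betw j I J" and iso: "\<And>i. i \<in> I \<Longrightarrow> algebra_isomorphic (A i) (B (j i))"
  shows "algebra_isomorphic (product_algebra I A) (product_algebra J B)"
proof -
  obtain f where iso_f: "\<And>i. i \<in> I \<Longrightarrow> f i \<in> ring_iso (A i) (B (j i))"
    and smult: "\<And>i c x. \<lbrakk>i \<in> I; x \<in> carrier (A i)\<rbrakk> \<Longrightarrow> f i (c \<odot>\<^bsub>A i\<^esub> x) = c \<odot>\<^bsub>B (j i)\<^esub> f i x"
    using iso unfolding algebra_isomorphic_def by metis
  then have f: "\<And>i. i \<in> I \<Longrightarrow> bij_betw (f i) (carrier (A i)) (carrier (B (j i)))"
    and hom_f: "\<And>i. i \<in> I \<Longrightarrow> f i \<in> ring_hom (A i) (B (j i))"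
    by (auto simp: ring_iso_def)
  note mult = ring_hom_mult[OF hom_f] and add = ring_hom_add[OF hom_f] and one = ring_hom_one[OF hom_f]
  \<comment> \<open>Components of the image are indexed by \<open>J\<close>, so the map reads its
    argument at the preimage \<open>t k\<close> of each index \<open>k\<close>.\<close>
  define t where "t = inv_into I j"
  have t: "t k \<in> I" "j (t k) = k" if "k \<in> J" for k
    using j that by (auto simp: t_def bij_betw_inv_into_right inv_into_into bij_betw_imp_surj_on)
  have tj: "t (j i) = i" "j i \<in> J" if "i \<in> I" for i
    using j that by (auto simp: t_def bij_betw_inv_into_left dest: bij_betwE)
  define g where "g = (\<lambda>i. inv_into (carrier (A i)) (f i))"
  have g: "g i y \<in> carrier (A i)" "f i (g i y) = y" if "i \<in> I" "y \<in> carrier (B (j i))" for i y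
    using f[OF that(1)] that(2)
    by (auto simp: g_def bij_betw_inv_into_right inv_into_into bij_betw_imp_surj_on)
  have gf: "g i (f i x) = x" "f i x \<in> carrier (B (j i))" if "i \<in> I" "x \<in> carrier (A i)" for i x
    using f[OF that(1)] that(2) by (auto simp: g_def bij_betw_inv_into_left dest: bij_betwE)
  have fJ: "f (t k) x \<in> carrier (B k)" if "k \<in> J" "x \<in> carrier (A (t k))" for k x
    using gf(2)[OF t(1)] t(2) that by simp
  have gJ: "f (t k) (g (t k) y) = y" if "k \<in> J" "y \<in> carrier (B k)" for k y
    using g(2)[OF t(1)] t(2) that by simp
  define F where "F = (\<lambda>x. \<lambda>k\<in>J. f (t k) (x (t k)))"
  have bij: "bij_betw F (carrier (product_algebra I A)) (carrier (product_algebra J B))"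
  proof (rule bij_betwI)
    show "F \<in> carrier (product_algebra I A) \<rightarrow> carrier (product_algebra J B)"
      by (auto simp: F_def product_algebra_def PiE_iff t intro!: fJ)
    show "(\<lambda>y. \<lambda>i\<in>I. g i (y (j i))) \<in> carrier (product_algebra J B) \<rightarrow> carrier (product_algebra I A)"
      by (auto simp: product_algebra_def PiE_iff tj intro!: g)
    show "(\<lambda>i\<in>I. g i (F x (j i))) = x" if "x \<in> carrier (product_algebra I A)" for x
      using that by (auto simp: F_def product_algebra_def fun_eq_iff PiE_iff extensional_def tj gf)
    show "F (\<lambda>i\<in>I. g i (y (j i))) = y" if "y \<in> carrier (product_algebra J B)" for y
      using that by (auto simp: F_def product_algebra_def fun_eq_iff PiE_iff extensional_def t gJ)
  qed
  have at: "x (t k) \<in> carrier (A (t k))" if "x \<in> (\<Pi>\<^sub>E i\<in>I. carrier (A i))" "k \<in> J" for x k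
    using that t by (auto simp: PiE_iff)
  have multJ: "f (t k) (x \<otimes>\<^bsub>A (t k)\<^esub> y) = f (t k) x \<otimes>\<^bsub>B k\<^esub> f (t k) y"
    and addJ: "f (t k) (x \<oplus>\<^bsub>A (t k)\<^esub> y) = f (t k) x \<oplus>\<^bsub>B k\<^esub> f (t k) y"
    if "k \<in> J" "x \<in> carrier (A (t k))" "y \<in> carrier (A (t k))" for k x y
    using that mult[of "t k" x y] add[of "t k" x y] t by simp_all
  show ?thesis
    by (rule algebra_isomorphicI[OF bij])
      (auto simp: F_def product_algebra_def fun_eq_iff multJ addJ one smult t at)
qed

section \<open>Maps between twisted group algebras\<close>

lemma carrier_twisted_group_algebra [simp]:
  "carrier (twisted_group_algebra G \<alpha>) = carrier G \<rightarrow>\<^sub>E UNIV"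
  by (simp add: twisted_group_algebra_def)

text \<open>With the constraint on the product moved into an indicator, the sums range over
  independent variables and can be exchanged.\<close>

lemma twisted_group_algebra_mult:
  assumes "finite (carrier G)"
  shows "a \<otimes>\<^bsub>twisted_group_algebra G \<alpha>\<^esub> b = (\<lambda>x\<in>carrier G. \<Sum>g\<in>carrier G. \<Sum>h\<in>carrier G.
    if g \<otimes>\<^bsub>G\<^esub> h = x then a g * b h * \<alpha> (g, h) else 0)"
proof -
  have "(\<Sum>(g, h)\<in>{(g, h) \<in> carrier G \<times> carrier G. g \<otimes>\<^bsub>G\<^esub> h = x}. a g * b h * \<alpha> (g, h))
      = (\<Sum>g\<in>carrier G. \<Sum>h\<in>carrier G. if g \<otimes>\<^bsub>G\<^esub> h = x then a g * b h * \<alpha> (g, h) else 0)" for x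
    unfolding sum.cartesian_product
    by (rule sum.mono_neutral_cong_left) (use assms in \<open>auto split: if_splits\<close>)
  then show ?thesis
    by (simp add: twisted_group_algebra_def)
qed

text \<open>The linear extension of the map taking the basis element of \<open>g\<close> to
  \<open>f g\<close> times that of \<open>p g\<close>. For \<open>p\<close> the identity it rescales
  the basis; for \<open>p\<close> a projection and \<open>f\<close> built from a character it is one
  component of a Fourier transform.\<close>

definition fiber_sum ::
    "('a, 'm) monoid_scheme \<Rightarrow> ('b, 'n) monoid_scheme \<Rightarrow> ('a \<Rightarrow> 'b) \<Rightarrow> ('a \<Rightarrow> complex)
      \<Rightarrow> ('a \<Rightarrow> complex) \<Rightarrow> 'b \<Rightarrow> complex" where
  "fiber_sum G Q p f a = (\<lambda>x\<in>carrier Q. \<Sum>g\<in>carrier G. if p g = x then f g * a g else 0)"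

lemma fiber_sum_add:
  "fiber_sum G Q p f (a \<oplus>\<^bsub>twisted_group_algebra G \<alpha>\<^esub> b)
    = fiber_sum G Q p f a \<oplus>\<^bsub>twisted_group_algebra Q \<beta>\<^esub> fiber_sum G Q p f b"
  by (auto simp: fiber_sum_def twisted_group_algebra_def fun_eq_iff distrib_left
      simp flip: sum.distrib intro!: sum.cong)

lemma fiber_sum_smult:
  "fiber_sum G Q p f (c \<odot>\<^bsub>twisted_group_algebra G \<alpha>\<^esub> a)
    = c \<odot>\<^bsub>twisted_group_algebra Q \<beta>\<^esub> fiber_sum G Q p f a"
  by (auto simp: fiber_sum_def twisted_group_algebra_def fun_eq_iff sum_distrib_left
      intro!: sum.cong)

lemma sum_swap_pairs:
  "(\<Sum>g\<in>C. \<Sum>h\<in>C. \<Sum>u\<in>D. \<Sum>v\<in>D. F g h u v) = (\<Sum>u\<in>D. \<Sum>v\<in>D. \<Sum>g\<in>C. \<Sum>h\<in>C. F g h u v)"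
proof -
  have swap3: "(\<Sum>g\<in>C. \<Sum>h\<in>C. \<Sum>u\<in>D. E g h u) = (\<Sum>u\<in>D. \<Sum>g\<in>C. \<Sum>h\<in>C. E g h u)" for E
    by (rule trans[OF sum.cong[OF refl sum.swap] sum.swap])
  show ?thesis
    by (rule trans[OF swap3 sum.cong[OF refl swap3]])
qed

text \<open>The hypothesis relating \<open>f\<close>, \<alpha> and \<beta> is multiplicativity on
  pairs of basis elements; the rest is bilinear extension.\<close>

lemma fiber_sum_mult:
  assumes "group G" and "group Q" and fin: "finite (carrier G)" "finite (carrier Q)"
    and p: "p \<in> hom G Q"
    and f: "\<And>g h. \<lbrakk>g \<in> carrier G; h \<in> carrier G\<rbrakk>
      \<Longrightarrow> f (g \<otimes>\<^bsub>G\<^esub> h) * \<alpha> (g, h) = f g * f h * \<beta> (p g, p h)"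
  shows "fiber_sum G Q p f (a \<otimes>\<^bsub>twisted_group_algebra G \<alpha>\<^esub> b)
    = fiber_sum G Q p f a \<otimes>\<^bsub>twisted_group_algebra Q \<beta>\<^esub> fiber_sum G Q p f b"
proof
  fix x
  interpret G: group G by fact
  let ?C = "carrier G" and ?D = "carrier Q"
  have pQ: "p g \<in> ?D" if "g \<in> ?C" for g
    using p that by (auto simp: hom_def)
  have pm: "p (g \<otimes>\<^bsub>G\<^esub> h) = p g \<otimes>\<^bsub>Q\<^esub> p h" if "g \<in> ?C" "h \<in> ?C" for g h
    using p that by (simp add: hom_mult)
  show "fiber_sum G Q p f (a \<otimes>\<^bsub>twisted_group_algebra G \<alpha>\<^esub> b) x
    = (fiber_sum G Q p f a \<otimes>\<^bsub>twisted_group_algebra Q \<beta>\<^esub> fiber_sum G Q p f b) x"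
  proof (cases "x \<in> ?D")
    case True
    have "fiber_sum G Q p f (a \<otimes>\<^bsub>twisted_group_algebra G \<alpha>\<^esub> b) x
      = (\<Sum>k\<in>?C. \<Sum>g\<in>?C. \<Sum>h\<in>?C.
          if g \<otimes>\<^bsub>G\<^esub> h = k then (if p k = x then f k * (a g * b h * \<alpha> (g, h)) else 0) else 0)"
      using True by (auto simp: fiber_sum_def twisted_group_algebra_mult fin sum_distrib_left
          if_distrib cong: if_cong intro!: sum.cong)
    also have "\<dots> = (\<Sum>g\<in>?C. \<Sum>h\<in>?C. \<Sum>k\<in>?C.
          if g \<otimes>\<^bsub>G\<^esub> h = k then (if p k = x then f k * (a g * b h * \<alpha> (g, h)) else 0) else 0)"
      by (rule trans[OF sum.swap], rule sum.cong[OF refl], rule sum.swap)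
    also have "\<dots> = (\<Sum>g\<in>?C. \<Sum>h\<in>?C.
          if p g \<otimes>\<^bsub>Q\<^esub> p h = x then f g * f h * \<beta> (p g, p h) * a g * b h else 0)"
    proof (intro sum.cong refl)
      fix g h
      assume gh: "g \<in> ?C" "h \<in> ?C"
      have "f (g \<otimes>\<^bsub>G\<^esub> h) * (a g * b h * \<alpha> (g, h)) = f g * f h * \<beta> (p g, p h) * a g * b h"
        by (simp flip: f[OF gh])
      then show "(\<Sum>k\<in>?C. if g \<otimes>\<^bsub>G\<^esub> h = k then (if p k = x then f k * (a g * b h * \<alpha> (g, h)) else 0) else 0)
        = (if p g \<otimes>\<^bsub>Q\<^esub> p h = x then f g * f h * \<beta> (p g, p h) * a g * b h else 0)"
        using gh fin by (simp add: pm)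
    qed
    \<comment> \<open>The images \<open>u\<close> of \<open>g\<close> and \<open>v\<close> of
      \<open>h\<close> become summation variables, so that after exchanging the order the sums over
      \<open>g\<close> and \<open>h\<close> factor.\<close>
    also have "\<dots> = (\<Sum>g\<in>?C. \<Sum>h\<in>?C. \<Sum>u\<in>?D. \<Sum>v\<in>?D. if p g = u then (if p h = v then
          (if u \<otimes>\<^bsub>Q\<^esub> v = x then f g * f h * \<beta> (u, v) * a g * b h else 0) else 0) else 0)"
    proof (intro sum.cong refl)
      fix g h
      assume gh: "g \<in> ?C" "h \<in> ?C"
      have "(\<Sum>u\<in>?D. \<Sum>v\<in>?D. if p g = u then (if p h = v then
          (if u \<otimes>\<^bsub>Q\<^esub> v = x then f g * f h * \<beta> (u, v) * a g * b h else 0) else 0) else 0)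
        = (\<Sum>u\<in>?D. if p g = u then (\<Sum>v\<in>?D. if p h = v then
          (if u \<otimes>\<^bsub>Q\<^esub> v = x then f g * f h * \<beta> (u, v) * a g * b h else 0) else 0) else 0)"
        by (intro sum.cong refl) simp
      then show "(if p g \<otimes>\<^bsub>Q\<^esub> p h = x then f g * f h * \<beta> (p g, p h) * a g * b h else 0)
        = (\<Sum>u\<in>?D. \<Sum>v\<in>?D. if p g = u then (if p h = v then
          (if u \<otimes>\<^bsub>Q\<^esub> v = x then f g * f h * \<beta> (u, v) * a g * b h else 0) else 0) else 0)"
        using gh fin by (simp add: pQ)
    qed
    also have "\<dots> = (\<Sum>u\<in>?D. \<Sum>v\<in>?D. \<Sum>g\<in>?C. \<Sum>h\<in>?C. if p g = u then (if p h = v then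
          (if u \<otimes>\<^bsub>Q\<^esub> v = x then f g * f h * \<beta> (u, v) * a g * b h else 0) else 0) else 0)"
      by (rule sum_swap_pairs)
    also have "\<dots> = (fiber_sum G Q p f a \<otimes>\<^bsub>twisted_group_algebra Q \<beta>\<^esub> fiber_sum G Q p f b) x"
    proof -
      have "(\<Sum>g\<in>?C. \<Sum>h\<in>?C. if p g = u then (if p h = v then
          (if u \<otimes>\<^bsub>Q\<^esub> v = x then f g * f h * \<beta> (u, v) * a g * b h else 0) else 0) else 0)
        = (if u \<otimes>\<^bsub>Q\<^esub> v = x then fiber_sum G Q p f a u * fiber_sum G Q p f b v * \<beta> (u, v) else 0)"
        if "u \<in> ?D" "v \<in> ?D" for u v
      proof (cases "u \<otimes>\<^bsub>Q\<^esub> v = x")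
        case True
        have "fiber_sum G Q p f a u * fiber_sum G Q p f b v * \<beta> (u, v) = (\<Sum>g\<in>?C. \<Sum>h\<in>?C.
            (if p g = u then f g * a g else 0) * (if p h = v then f h * b h else 0) * \<beta> (u, v))"
          by (simp only: fiber_sum_def restrict_apply' that, simp only: sum_product, simp only: sum_distrib_right)
        with True show ?thesis
          by (auto intro!: sum.cong)
      next
        case False
        then show ?thesis
          by (simp cong: if_cong)
      qed
      with True show ?thesis
        by (simp add: twisted_group_algebra_mult fin)
    qed
    finally show ?thesis .
  qed (simp add: fiber_sum_def twisted_group_algebra_def)
qed

text \<open>The units carry the inverses of \<open>\<alpha> (1, 1)\<close> and
  \<open>\<beta> (1, 1)\<close>. The relation at the pair of identities, cancelled by
  \<open>f\<close> at the identity, says that these correspond.\<close>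

lemma fiber_sum_one:
  assumes "group G" and "group Q" and fin: "finite (carrier G)" and p: "p \<in> hom G Q"
    and nz: "f \<one>\<^bsub>G\<^esub> \<noteq> 0" "\<alpha> (\<one>\<^bsub>G\<^esub>, \<one>\<^bsub>G\<^esub>) \<noteq> 0"
    and f: "\<And>g h. \<lbrakk>g \<in> carrier G; h \<in> carrier G\<rbrakk>
      \<Longrightarrow> f (g \<otimes>\<^bsub>G\<^esub> h) * \<alpha> (g, h) = f g * f h * \<beta> (p g, p h)"
  shows "fiber_sum G Q p f \<one>\<^bsub>twisted_group_algebra G \<alpha>\<^esub> = \<one>\<^bsub>twisted_group_algebra Q \<beta>\<^esub>"
proof -
  interpret G: group G by fact
  interpret Q: group Q by fact
  have p1: "p \<one>\<^bsub>G\<^esub> = \<one>\<^bsub>Q\<^esub>"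
    using p assms(1,2) by (simp add: hom_one)
  have "f \<one>\<^bsub>G\<^esub> * \<alpha> (\<one>\<^bsub>G\<^esub>, \<one>\<^bsub>G\<^esub>) = f \<one>\<^bsub>G\<^esub> * f \<one>\<^bsub>G\<^esub> * \<beta> (\<one>\<^bsub>Q\<^esub>, \<one>\<^bsub>Q\<^esub>)"
    using f[of "\<one>\<^bsub>G\<^esub>" "\<one>\<^bsub>G\<^esub>"] by (simp add: p1)
  then have *: "f \<one>\<^bsub>G\<^esub> * inverse (\<alpha> (\<one>\<^bsub>G\<^esub>, \<one>\<^bsub>G\<^esub>)) = inverse (\<beta> (\<one>\<^bsub>Q\<^esub>, \<one>\<^bsub>Q\<^esub>))"
    using nz by (auto simp: field_simps)
  have "(\<Sum>g\<in>carrier G. if p g = x then f g * \<one>\<^bsub>twisted_group_algebra G \<alpha>\<^esub> g else 0)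
      = (if x = \<one>\<^bsub>Q\<^esub> then inverse (\<beta> (\<one>\<^bsub>Q\<^esub>, \<one>\<^bsub>Q\<^esub>)) else 0)" for x
  proof -
    have "(\<Sum>g\<in>carrier G. if p g = x then f g * \<one>\<^bsub>twisted_group_algebra G \<alpha>\<^esub> g else 0)
      = (\<Sum>g\<in>carrier G. if g = \<one>\<^bsub>G\<^esub> then (if x = \<one>\<^bsub>Q\<^esub> then f \<one>\<^bsub>G\<^esub> * inverse (\<alpha> (\<one>\<^bsub>G\<^esub>, \<one>\<^bsub>G\<^esub>)) else 0) else 0)"
      by (intro sum.cong) (auto simp: p1 twisted_group_algebra_def)
    then show ?thesis
      using fin by (simp add: *)
  qed
  then have "fiber_sum G Q p f \<one>\<^bsub>twisted_group_algebra G \<alpha>\<^esub>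
      = (\<lambda>x\<in>carrier Q. if x = \<one>\<^bsub>Q\<^esub> then inverse (\<beta> (\<one>\<^bsub>Q\<^esub>, \<one>\<^bsub>Q\<^esub>)) else 0)"
    unfolding fiber_sum_def by presburger
  then show ?thesis
    by (simp add: twisted_group_algebra_def[of Q])
qed

text \<open>If \<beta> is \<alpha> times the coboundary of \<open>f\<close>, rescaling each basis
  element by the inverse of \<open>f\<close> is the isomorphism.\<close>

lemma algebra_isomorphic_cohomologous:
  assumes "group G" and fin: "finite (carrier G)"
    and \<alpha>: "\<alpha> \<in> cocycles G" and "\<beta> \<in> cohomology_class G \<alpha>"
  shows "algebra_isomorphic (twisted_group_algebra G \<alpha>) (twisted_group_algebra G \<beta>)"
proof -
  interpret group G by fact
  obtain f where f: "\<And>x. x \<in> carrier G \<Longrightarrow> f x \<noteq> 0"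
    and \<beta>: "\<And>x y. \<lbrakk>x \<in> carrier G; y \<in> carrier G\<rbrakk> \<Longrightarrow> \<beta> (x, y) = f x * f y / f (x \<otimes>\<^bsub>G\<^esub> y) * \<alpha> (x, y)"
    using assms(4) cohomology_class_iff[OF \<alpha>] by blast
  define F where "F = fiber_sum G G (\<lambda>x. x) (\<lambda>x. inverse (f x))"
  have F: "F a = (\<lambda>x\<in>carrier G. inverse (f x) * a x)" for a
    using fin by (auto simp: F_def fiber_sum_def fun_eq_iff)
  have id: "(\<lambda>x. x) \<in> hom G G"
    by (simp add: hom_def)
  have rel: "inverse (f (g \<otimes>\<^bsub>G\<^esub> h)) * \<alpha> (g, h) = inverse (f g) * inverse (f h) * \<beta> (g, h)"
    if "g \<in> carrier G" "h \<in> carrier G" for g h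
    using f[OF that(1)] f[OF that(2)] by (simp add: \<beta>[OF that] divide_simps)
  have nz: "inverse (f \<one>\<^bsub>G\<^esub>) \<noteq> 0" "\<alpha> (\<one>\<^bsub>G\<^esub>, \<one>\<^bsub>G\<^esub>) \<noteq> 0"
    using f \<alpha> by (auto simp: cocycles_nonzero)
  have bij: "bij_betw F (carrier (twisted_group_algebra G \<alpha>)) (carrier (twisted_group_algebra G \<beta>))"
    by (rule bij_betwI[of _ _ _ "\<lambda>b. \<lambda>x\<in>carrier G. f x * b x"])
      (use f in \<open>auto simp: F fun_eq_iff PiE_iff extensional_def\<close>)
  show ?thesis
    by (rule algebra_isomorphicI[OF bij], unfold F_def)
      (use fiber_sum_mult[OF assms(1,1) fin fin id rel] fiber_sum_one[OF assms(1,1) fin id nz rel]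
        in \<open>simp_all add: fiber_sum_add fiber_sum_smult\<close>)
qed

subsection \<open>Inflation along a central extension\<close>

text \<open>Any central subgroup is allowed here; derived subgroups make themselves felt only
  through the symmetry assumption of the surjectivity lemmas. The unfolding rules of the factor
  group are removed from the simplifier below, so that \<open>Q\<close> is handled as an abstract
  group.\<close>

locale central_extension = group G for G :: "('a, 'm) monoid_scheme" (structure) +
  fixes Z :: "'a set" and \<mu> :: "'a set \<Rightarrow> 'a"
  assumes finite_carrier: "finite (carrier G)"
    and subgroup_Z: "subgroup Z G"
    and central: "\<lbrakk>z \<in> Z; g \<in> carrier G\<rbrakk> \<Longrightarrow> z \<otimes> g = g \<otimes> z"
    and section_mu: "is_section G Z \<mu>"
begin

declare mult_FactGroup [simp del] one_FactGroup [simp del]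

abbreviation Q :: "'a set monoid" where
  "Q \<equiv> G Mod Z"

lemma Z_closed: "z \<in> Z \<Longrightarrow> z \<in> carrier G"
  using subgroup_Z by (rule subgroup.mem_carrier)

lemma normal_Z: "normal Z G"
  unfolding normal_inv_iff
proof (intro conjI ballI subgroup_Z)
  fix x z assume "x \<in> carrier G" "z \<in> Z"
  then have "x \<otimes> z \<otimes> inv x = z"
    using central[of z x] by (simp add: Z_closed inv_solve_right')
  with \<open>z \<in> Z\<close> show "x \<otimes> z \<otimes> inv x \<in> Z"
    by simp
qed

sublocale Z: normal Z G
  by (rule normal_Z)

sublocale Q: group Q
  by (rule Z.factorgroup_is_group)

lemma finite_Q: "finite (carrier Q)"
  using finite_carrier by (simp add: carrier_FactGroup)

sublocale K: comm_group "G\<lparr>carrier := Z\<rparr>"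
  by (rule group.group_comm_groupI) (auto simp: subgroup_imp_group subgroup_Z central Z_closed)

lemma finite_Z: "finite Z"
  using finite_carrier Z.subset by (rule finite_subset[rotated])

section \<open>Coordinates relative to the section\<close>

definition proj :: "'a \<Rightarrow> 'a set" where
  "proj g = Z #> g"

lemma proj_hom: "proj \<in> hom G Q"
  using Z.r_coset_hom_Mod by (simp add: proj_def[abs_def])

lemma proj_closed [simp]: "g \<in> carrier G \<Longrightarrow> proj g \<in> carrier Q"
  using proj_hom by (auto simp: hom_def)

lemma proj_mult: "\<lbrakk>g \<in> carrier G; h \<in> carrier G\<rbrakk> \<Longrightarrow> proj (g \<otimes> h) = proj g \<otimes>\<^bsub>Q\<^esub> proj h"
  using proj_hom by (rule hom_mult)

lemma mu_closed [simp]: "x \<in> carrier Q \<Longrightarrow> \<mu> x \<in> carrier G"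
  using section_mu by (auto simp: is_section_def)

lemma proj_mu [simp]: "x \<in> carrier Q \<Longrightarrow> proj (\<mu> x) = x"
  using section_mu by (auto simp: is_section_def proj_def)

lemma proj_mult_Z [simp]: "\<lbrakk>z \<in> Z; g \<in> carrier G\<rbrakk> \<Longrightarrow> proj (z \<otimes> g) = proj g"
  unfolding proj_def by (simp add: Z_closed coset_mult_assoc[symmetric] Z.rcos_const Z.subset)

text \<open>The \<open>Z\<close>-coordinate of \<open>g\<close>. As \<mu> may take the trivial coset
  to any element of \<open>Z\<close>, \<open>rho\<close> is the identity on \<open>Z\<close> only up
  to a constant factor.\<close>

definition rho :: "'a \<Rightarrow> 'a" where
  "rho g = g \<otimes> inv (\<mu> (proj g))"

lemma rho_in_Z [simp]: "g \<in> carrier G \<Longrightarrow> rho g \<in> Z"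
  unfolding rho_def
  by (metis Z.rcos_module_imp is_group mu_closed proj_closed proj_def proj_mu rcos_self subgroup_Z)

lemma rho_decomp: "g \<in> carrier G \<Longrightarrow> rho g \<otimes> \<mu> (proj g) = g"
  by (simp add: rho_def m_assoc)

lemma rho_mult_Z: "\<lbrakk>z \<in> Z; g \<in> carrier G\<rbrakk> \<Longrightarrow> rho (z \<otimes> g) = z \<otimes> rho g"
  by (simp add: rho_def m_assoc Z_closed)

lemma rho_mu: "x \<in> carrier Q \<Longrightarrow> rho (\<mu> x) = \<one>"
  by (simp add: rho_def)

lemma eq_if_rho_eq: "\<lbrakk>g \<in> carrier G; h \<in> carrier G; proj g = proj h; rho g = rho h\<rbrakk> \<Longrightarrow> g = h"
  by (metis rho_decomp)

text \<open>The \<open>Z\<close>-valued cocycle of the extension; characters are applied to it in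
  \<open>transgression\<close>.\<close>

definition factor_set :: "'a set \<Rightarrow> 'a set \<Rightarrow> 'a" where
  "factor_set x y = \<mu> x \<otimes> \<mu> y \<otimes> inv (\<mu> (x \<otimes>\<^bsub>Q\<^esub> y))"

lemma factor_set_eq: "\<lbrakk>x \<in> carrier Q; y \<in> carrier Q\<rbrakk> \<Longrightarrow> factor_set x y = rho (\<mu> x \<otimes> \<mu> y)"
  by (simp add: factor_set_def rho_def proj_mult)

lemma factor_set_in_Z [simp]: "\<lbrakk>x \<in> carrier Q; y \<in> carrier Q\<rbrakk> \<Longrightarrow> factor_set x y \<in> Z"
  by (simp add: factor_set_eq)

lemma mu_mult:
  "\<lbrakk>x \<in> carrier Q; y \<in> carrier Q\<rbrakk> \<Longrightarrow> \<mu> x \<otimes> \<mu> y = factor_set x y \<otimes> \<mu> (x \<otimes>\<^bsub>Q\<^esub> y)"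
  using rho_decomp[of "\<mu> x \<otimes> \<mu> y"] by (simp add: factor_set_eq proj_mult)

text \<open>Centrality moves \<open>rho h\<close> past \<open>\<mu> (proj g)\<close>. Composed with
  a character, the formula exhibits the inflated transgression cocycle as a coboundary; the Fourier
  components are multiplicative for the same reason.\<close>

lemma rho_mult:
  assumes g: "g \<in> carrier G" and h: "h \<in> carrier G"
  shows "rho (g \<otimes> h) = rho g \<otimes> rho h \<otimes> factor_set (proj g) (proj h)"
proof -
  have "g \<otimes> h = (rho g \<otimes> \<mu> (proj g)) \<otimes> (rho h \<otimes> \<mu> (proj h))"
    using g h by (simp add: rho_decomp)
  also have "\<dots> = rho g \<otimes> (\<mu> (proj g) \<otimes> rho h) \<otimes> \<mu> (proj h)"
    using g h by (simp add: m_assoc Z_closed)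
  also have "\<dots> = rho g \<otimes> (rho h \<otimes> \<mu> (proj g)) \<otimes> \<mu> (proj h)"
    using g h by (simp add: central[of "rho h" "\<mu> (proj g)"])
  also have "\<dots> = (rho g \<otimes> rho h) \<otimes> (\<mu> (proj g) \<otimes> \<mu> (proj h))"
    using g h by (simp add: m_assoc Z_closed)
  finally show ?thesis
    using g h by (simp add: rho_mult_Z factor_set_eq)
qed

section \<open>Transgression cocycles\<close>

abbreviation chars :: "('a \<Rightarrow> complex) set" where
  "chars \<equiv> carrier (character_group G Z)"

lemma chars_eq: "chars = K.chars"
  by (simp add: character_group_def K.chars_def)

lemma char_nonzero [simp]: "\<lbrakk>\<chi> \<in> chars; z \<in> Z\<rbrakk> \<Longrightarrow> \<chi> z \<noteq> 0"
  using K.chars_nonzero by (simp add: chars_eq)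

lemma char_mult: "\<lbrakk>\<chi> \<in> chars; z \<in> Z; w \<in> Z\<rbrakk> \<Longrightarrow> \<chi> (z \<otimes> w) = \<chi> z * \<chi> w"
  using K.chars_mult by (simp add: chars_eq)

lemma char_one: "\<chi> \<in> chars \<Longrightarrow> \<chi> \<one> = 1"
  using K.chars_one by (simp add: chars_eq)

lemma char_rho_mult:
  "\<lbrakk>\<chi> \<in> chars; g \<in> carrier G; h \<in> carrier G\<rbrakk>
    \<Longrightarrow> \<chi> (rho (g \<otimes> h)) = \<chi> (rho g) * \<chi> (rho h) * \<chi> (factor_set (proj g) (proj h))"
  by (simp add: rho_mult char_mult)

definition tra_cocycle :: "('a \<Rightarrow> complex) \<Rightarrow> 'a set \<times> 'a set \<Rightarrow> complex" where
  "tra_cocycle \<chi> = (\<lambda>(x, y)\<in>carrier Q \<times> carrier Q. \<chi> (factor_set x y))"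

lemma transgression_eq: "transgression G Z \<mu> \<chi> = cohomology_class Q (tra_cocycle \<chi>)"
  by (simp add: transgression_def tra_cocycle_def factor_set_def)

text \<open>Associativity in \<open>G\<close>: the character of the \<open>Z\<close>-coordinate of
  \<open>\<mu> x \<otimes> \<mu> y \<otimes> \<mu> z\<close> is computed for both
  bracketings.\<close>

lemma tra_cocycle_cocycles:
  assumes \<chi>: "\<chi> \<in> chars"
  shows "tra_cocycle \<chi> \<in> cocycles Q"
  unfolding tra_cocycle_def
proof (rule Q.cocyclesI)
  fix x y z
  assume xyz: "x \<in> carrier Q" "y \<in> carrier Q" "z \<in> carrier Q"
  have "\<chi> (rho (\<mu> x \<otimes> \<mu> y \<otimes> \<mu> z)) = \<chi> (factor_set x y) * \<chi> (factor_set (x \<otimes>\<^bsub>Q\<^esub> y) z)"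
    using xyz \<chi> char_rho_mult[OF \<chi>, of "\<mu> x \<otimes> \<mu> y" "\<mu> z"]
    by (simp add: proj_mult rho_mu char_one flip: factor_set_eq)
  moreover have "\<chi> (rho (\<mu> x \<otimes> (\<mu> y \<otimes> \<mu> z))) = \<chi> (factor_set y z) * \<chi> (factor_set x (y \<otimes>\<^bsub>Q\<^esub> z))"
    using xyz \<chi> char_rho_mult[OF \<chi>, of "\<mu> x" "\<mu> y \<otimes> \<mu> z"]
    by (simp add: proj_mult rho_mu char_one flip: factor_set_eq)
  ultimately show "\<chi> (factor_set x y) * \<chi> (factor_set (x \<otimes>\<^bsub>Q\<^esub> y) z)
      = \<chi> (factor_set y z) * \<chi> (factor_set x (y \<otimes>\<^bsub>Q\<^esub> z))"
    using xyz by (simp add: m_assoc)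
qed (use \<chi> in simp)

section \<open>Inflation of cocycles, its kernel and its image\<close>

definition inflation :: "('a set \<times> 'a set \<Rightarrow> complex) \<Rightarrow> 'a \<times> 'a \<Rightarrow> complex" where
  "inflation a = (\<lambda>(g, h)\<in>carrier G \<times> carrier G. a (proj g, proj h))"

lemma inflation_apply [simp]:
  "\<lbrakk>g \<in> carrier G; h \<in> carrier G\<rbrakk> \<Longrightarrow> inflation a (g, h) = a (proj g, proj h)"
  by (simp add: inflation_def)

lemma inflation_cocycles:
  assumes a: "a \<in> cocycles Q"
  shows "inflation a \<in> cocycles G"
  unfolding inflation_def
proof (rule cocyclesI)
  fix x y z
  assume "x \<in> carrier G" "y \<in> carrier G" "z \<in> carrier G"
  then show "a (proj x, proj y) * a (proj (x \<otimes> y), proj z) = a (proj y, proj z) * a (proj x, proj (y \<otimes> z))"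
    using cocycles_identity[OF a, of "proj x" "proj y" "proj z"] by (simp add: proj_mult)
qed (use a in \<open>simp add: cocycles_nonzero\<close>)

lemma inflation_class_cong:
  assumes a: "a \<in> cocycles Q" and b: "b \<in> cohomology_class Q a"
  shows "cohomology_class G (inflation a) = cohomology_class G (inflation b)"
proof -
  obtain f where f: "\<And>x. x \<in> carrier Q \<Longrightarrow> f x \<noteq> 0" and bQ: "b \<in> cocycles Q"
    and b: "\<And>x y. \<lbrakk>x \<in> carrier Q; y \<in> carrier Q\<rbrakk> \<Longrightarrow> b (x, y) = f x * f y / f (x \<otimes>\<^bsub>Q\<^esub> y) * a (x, y)"
    using b Q.cohomology_class_iff[OF a] by blast
  show ?thesis
    by (rule cohomology_class_eqI[of _ _ "\<lambda>g. f (proj g)"])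
      (use a bQ f b in \<open>simp_all add: inflation_cocycles proj_mult\<close>)
qed

lemma inflation_mult:
  "inflation (\<lambda>p\<in>carrier Q \<times> carrier Q. a p * b p) = (\<lambda>p\<in>carrier G \<times> carrier G. inflation a p * inflation b p)"
  by (auto simp: inflation_def fun_eq_iff)

lemma inflation_tra_cocycle:
  assumes \<chi>: "\<chi> \<in> chars"
  shows "cohomology_class G (inflation (tra_cocycle \<chi>)) = cohomology_class G (\<lambda>p\<in>carrier G \<times> carrier G. 1)"
proof (rule cohomology_class_eqI[of _ _ "\<lambda>g. \<chi> (rho g)"])
  fix x y assume xy: "x \<in> carrier G" "y \<in> carrier G"
  then show "(\<lambda>p\<in>carrier G \<times> carrier G. 1) (x, y)
      = \<chi> (rho x) * \<chi> (rho y) / \<chi> (rho (x \<otimes> y)) * inflation (tra_cocycle \<chi>) (x, y)"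
    using \<chi> by (simp add: tra_cocycle_def char_rho_mult)
qed (use \<chi> in \<open>simp_all add: inflation_cocycles tra_cocycle_cocycles one_cocycles\<close>)

text \<open>A function trivializing the inflation of \<open>a\<close> is, on \<open>Z\<close>, a
  character up to a constant. Its values on the section give the coboundary between \<open>a\<close>
  and a transgression cocycle.\<close>

lemma inflation_kernel:
  assumes a: "a \<in> cocycles Q"
    and eq: "cohomology_class G (inflation a) = cohomology_class G (\<lambda>p\<in>carrier G \<times> carrier G. 1)"
  shows "\<exists>\<chi>\<in>chars. cohomology_class Q a = transgression G Z \<mu> \<chi>"
proof -
  have "inflation a \<in> cohomology_class G (\<lambda>p\<in>carrier G \<times> carrier G. 1)"
    using a eq cohomology_class_self inflation_cocycles by metis
  then obtain f where f: "\<And>g. g \<in> carrier G \<Longrightarrow> f g \<noteq> 0"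
    and "\<And>g h. \<lbrakk>g \<in> carrier G; h \<in> carrier G\<rbrakk> \<Longrightarrow> inflation a (g, h)
        = f g * f h / f (g \<otimes> h) * (\<lambda>p\<in>carrier G \<times> carrier G. 1) (g, h)"
    unfolding cohomology_class_iff[OF one_cocycles] by blast
  then have fa: "f g * f h = a (proj g, proj h) * f (g \<otimes> h)" if "g \<in> carrier G" "h \<in> carrier G" for g h
    using that f by simp
  \<comment> \<open>The common value of \<open>a\<close> on all pairs with first entry 1;
    \<open>f\<close> is multiplicative on \<open>Z\<close> only after division by it.\<close>
  define c where "c = a (\<one>\<^bsub>Q\<^esub>, \<one>\<^bsub>Q\<^esub>)"
  have c: "c \<noteq> 0"
    using cocycles_nonzero[OF a] by (simp add: c_def)
  have a1: "a (\<one>\<^bsub>Q\<^esub>, x) = c" if "x \<in> carrier Q" for x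
    using cocycles_identity[OF a, of "\<one>\<^bsub>Q\<^esub>" "\<one>\<^bsub>Q\<^esub>" x] cocycles_nonzero[OF a, of "\<one>\<^bsub>Q\<^esub>" x] that
    by (simp add: c_def)
  have proj_Z: "proj z = \<one>\<^bsub>Q\<^esub>" if "z \<in> Z" for z
    using that by (simp add: proj_def Z.rcos_const one_FactGroup)
  have fZ: "f (z \<otimes> g) = f z / c * f g" if "z \<in> Z" "g \<in> carrier G" for z g
    using fa[of z g] that c by (simp add: proj_Z a1 Z_closed field_simps)
  \<comment> \<open>The reciprocal of that character, because the value of \<open>f\<close> at the
    factor set moves to the denominator when the relation is solved for
    \<open>a (x, y)\<close>.\<close>
  define \<chi> where "\<chi> = (\<lambda>z\<in>Z. c / f z)"
  have \<chi>: "\<chi> \<in> chars"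
    unfolding chars_eq \<chi>_def
    using f c K.charsI[of "\<lambda>z. c / f z"] by (simp add: Z_closed fZ)
  have "cohomology_class Q (tra_cocycle \<chi>) = cohomology_class Q a"
  proof (rule Q.cohomology_class_eqI[of _ _ "\<lambda>x. f (\<mu> x)"])
    fix x y assume xy: "x \<in> carrier Q" "y \<in> carrier Q"
    have "f (\<mu> x) * f (\<mu> y) = a (x, y) * f (factor_set x y \<otimes> \<mu> (x \<otimes>\<^bsub>Q\<^esub> y))"
      using fa[of "\<mu> x" "\<mu> y"] xy by (simp add: mu_mult)
    then have eq: "f (\<mu> x) * f (\<mu> y) = a (x, y) * (f (factor_set x y) / c * f (\<mu> (x \<otimes>\<^bsub>Q\<^esub> y)))"
      using xy by (simp add: fZ)
    show "a (x, y) = f (\<mu> x) * f (\<mu> y) / f (\<mu> (x \<otimes>\<^bsub>Q\<^esub> y)) * tra_cocycle \<chi> (x, y)"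
      unfolding eq using xy f c by (simp add: tra_cocycle_def \<chi>_def Z_closed)
  qed (use \<chi> a f in \<open>simp_all add: tra_cocycle_cocycles\<close>)
  then have "cohomology_class Q a = transgression G Z \<mu> \<chi>"
    by (simp add: transgression_eq)
  with \<chi> show ?thesis
    by blast
qed

lemma inflation_surjective:
  assumes \<alpha>: "\<alpha> \<in> cocycles G"
    and sym: "\<And>z g. \<lbrakk>z \<in> Z; g \<in> carrier G\<rbrakk> \<Longrightarrow> \<alpha> (z, g) = \<alpha> (g, z)"
  shows "\<exists>a\<in>cocycles Q. cohomology_class G \<alpha> = cohomology_class G (inflation a)"
proof -
  interpret S: symmetric_cocycle "G\<lparr>carrier := Z\<rparr>" \<alpha>
  proof unfold_locales
    fix x y
    assume "x \<in> carrier (G\<lparr>carrier := Z\<rparr>)" "y \<in> carrier (G\<lparr>carrier := Z\<rparr>)"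
    then show "\<alpha> (x, y) = \<alpha> (y, x)"
      using sym[of x y] by (simp add: Z_closed)
  qed (simp_all add: finite_Z Z_closed cocycles_nonzero[OF \<alpha>] cocycles_identity[OF \<alpha>])
  obtain s where s: "\<And>z. z \<in> Z \<Longrightarrow> s z \<noteq> 0"
    and s_mult: "\<And>z y. \<lbrakk>z \<in> Z; y \<in> Z\<rbrakk> \<Longrightarrow> s z * s y = \<alpha> (z, y) * s (z \<otimes> y)"
    using S.ex_trivialization by auto
  \<comment> \<open>The inverse of \<open>s\<close> cancels \<alpha> on \<open>Z\<close>; outside
    \<open>Z\<close> any nonzero values would do.\<close>
  define f where "f = (\<lambda>g. if g \<in> Z then inverse (s g) else 1)"
  have f: "f g \<noteq> 0" for g
    using s by (simp add: f_def)
  define \<beta> where "\<beta> = (\<lambda>(x, y)\<in>carrier G \<times> carrier G. f x * f y / f (x \<otimes> y) * \<alpha> (x, y))"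
  have \<beta>: "\<beta> \<in> cocycles G"
    unfolding \<beta>_def using \<alpha> f by (rule cocycles_mult_coboundary)
  have \<beta>_sym: "\<beta> (g, z) = \<beta> (z, g)" if "z \<in> Z" "g \<in> carrier G" for z g
    using that sym central by (simp add: \<beta>_def Z_closed)
  have \<beta>_Z: "\<beta> (z, w) = 1" if "z \<in> Z" "w \<in> Z" for z w
    using that s s_mult[of z w] cocycles_nonzero[OF \<alpha>, of z w]
    by (simp add: \<beta>_def f_def Z_closed field_simps)
  \<comment> \<open>With \<open>\<beta> = 1\<close> on \<open>Z \<times> Z\<close>, rescaling by \<open>r\<close> achieves \<open>\<gamma> = 1\<close> on \<open>Z \<times> G\<close>, and
    the cocycle identity then makes \<open>\<gamma>\<close> invariant under \<open>Z\<close> in both arguments.\<close>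
  define r where "r = (\<lambda>g. \<beta> (rho g, \<mu> (proj g)))"
  have r: "r g \<noteq> 0" if "g \<in> carrier G" for g
    using that by (simp add: r_def cocycles_nonzero[OF \<beta>] Z_closed)
  define \<gamma> where "\<gamma> = (\<lambda>(x, y)\<in>carrier G \<times> carrier G. r x * r y / r (x \<otimes> y) * \<beta> (x, y))"
  have \<gamma>: "\<gamma> \<in> cocycles G"
    unfolding \<gamma>_def using \<beta> r by (rule cocycles_mult_coboundary)
  have \<gamma>_left: "\<gamma> (z, g) = 1" if z: "z \<in> Z" and g: "g \<in> carrier G" for z g
  proof -
    \<comment> \<open>The representative of the trivial coset may differ from 1, but it lies in
      \<open>Z\<close>, where \<beta> is already 1.\<close>
    have "\<mu> (proj z) = inv (rho z) \<otimes> z"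
      using z rho_decomp[of z] by (metis Z_closed inv_solve_left mu_closed proj_closed rho_in_Z)
    then have "\<mu> (proj z) \<in> Z"
      using z by (simp add: Z_closed)
    then have "r z = 1"
      using z by (simp add: r_def \<beta>_Z Z_closed)
    \<comment> \<open>In the algebra twisted by \<beta>, \<open>r g\<close> times the basis element
      of \<open>g\<close> is the product of the basis elements of \<open>rho g\<close> and
      \<open>\<mu> (proj g)\<close>. Left multiplication by \<open>z\<close> changes only the first
      of these, and on \<open>Z\<close> it costs no factor.\<close>
    moreover have "r (z \<otimes> g) = \<beta> (z, g) * r g"
      using cocycles_identity[OF \<beta>, of z "rho g" "\<mu> (proj g)"] z g
      by (simp add: r_def rho_mult_Z \<beta>_Z Z_closed rho_decomp mult.commute)
    moreover have "r g \<noteq> 0" "\<beta> (z, g) \<noteq> 0"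
      using z g by (simp_all add: r cocycles_nonzero[OF \<beta>] Z_closed)
    ultimately show ?thesis
      using z g by (simp add: \<gamma>_def Z_closed)
  qed
  have \<gamma>_right: "\<gamma> (g, z) = 1" if z: "z \<in> Z" and g: "g \<in> carrier G" for z g
  proof -
    have "\<gamma> (g, z) = \<gamma> (z, g)"
      using z g by (simp add: \<gamma>_def \<beta>_sym[OF z g] central[OF z g] Z_closed mult.commute)
    then show ?thesis
      by (simp add: \<gamma>_left[OF z g])
  qed
  have \<gamma>_shift_left: "\<gamma> (z \<otimes> g, h) = \<gamma> (g, h)" if "z \<in> Z" "g \<in> carrier G" "h \<in> carrier G" for z g h
    using cocycles_identity[OF \<gamma>, of z g h] that by (simp add: \<gamma>_left Z_closed)
  have \<gamma>_shift_right: "\<gamma> (g, z \<otimes> h) = \<gamma> (g, h)" if "z \<in> Z" "g \<in> carrier G" "h \<in> carrier G" for z g h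
    using cocycles_identity[OF \<gamma>, of g h z] that central[of z h] by (simp add: \<gamma>_right Z_closed)
  define a where "a = (\<lambda>(x, y)\<in>carrier Q \<times> carrier Q. \<gamma> (\<mu> x, \<mu> y))"
  have a_proj: "a (proj g, proj h) = \<gamma> (g, h)" if "g \<in> carrier G" "h \<in> carrier G" for g h
    using \<gamma>_shift_left[of "rho g" "\<mu> (proj g)" h] \<gamma>_shift_right[of "rho h" "\<mu> (proj g)" "\<mu> (proj h)"] that
    by (simp add: a_def rho_decomp)
  have a: "a \<in> cocycles Q"
    unfolding a_def
  proof (rule Q.cocyclesI)
    fix x y z
    assume xyz: "x \<in> carrier Q" "y \<in> carrier Q" "z \<in> carrier Q"
    have "\<gamma> (\<mu> (x \<otimes>\<^bsub>Q\<^esub> y), \<mu> z) = \<gamma> (\<mu> x \<otimes> \<mu> y, \<mu> z)" "\<gamma> (\<mu> x, \<mu> (y \<otimes>\<^bsub>Q\<^esub> z)) = \<gamma> (\<mu> x, \<mu> y \<otimes> \<mu> z)"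
      using xyz by (simp_all add: mu_mult \<gamma>_shift_left \<gamma>_shift_right)
    then show "\<gamma> (\<mu> x, \<mu> y) * \<gamma> (\<mu> (x \<otimes>\<^bsub>Q\<^esub> y), \<mu> z) = \<gamma> (\<mu> y, \<mu> z) * \<gamma> (\<mu> x, \<mu> (y \<otimes>\<^bsub>Q\<^esub> z))"
      using xyz cocycles_identity[OF \<gamma>] by simp
  qed (simp add: cocycles_nonzero[OF \<gamma>])
  have "inflation a = \<gamma>"
    by (rule cocycles_eqI[OF inflation_cocycles[OF a] \<gamma>]) (simp add: a_proj)
  moreover have "cohomology_class G \<alpha> = cohomology_class G \<beta>"
    by (rule cohomology_class_eqI[OF \<alpha> \<beta>, of f]) (use f in \<open>simp_all add: \<beta>_def\<close>)
  moreover have "cohomology_class G \<beta> = cohomology_class G \<gamma>"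
    by (rule cohomology_class_eqI[OF \<beta> \<gamma>, of r]) (use r in \<open>simp_all add: \<gamma>_def\<close>)
  ultimately show ?thesis
    using a by auto
qed

section \<open>Fourier transform along the central subgroup\<close>

lemma sum_fiber:
  assumes x: "x \<in> carrier Q"
  shows "(\<Sum>g\<in>carrier G. if proj g = x then F (rho g) else 0) = (\<Sum>z\<in>Z. F z :: complex)"
proof -
  have "(\<Sum>g\<in>carrier G. if proj g = x then F (rho g) else 0) = (\<Sum>g\<in>{g \<in> carrier G. proj g = x}. F (rho g))"
    using finite_carrier by (simp add: sum.inter_filter)
  also have "\<dots> = (\<Sum>z\<in>Z. F z)"
    by (rule sum.reindex_bij_witness[of _ "\<lambda>z. z \<otimes> \<mu> x" rho])
      (use x in \<open>auto simp: rho_decomp rho_mult_Z rho_mu Z_closed\<close>)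
  finally show ?thesis .
qed

text \<open>The component at \<chi> takes the basis element of \<open>g\<close> to
  \<open>\<chi> (rho g)\<close> times that of its coset. The factor set measures how far
  \<open>rho\<close> is from a homomorphism, and it adds the transgression cocycle of \<chi> to the
  twist.\<close>

lemma algebra_isomorphic_inflation:
  assumes a: "a \<in> cocycles Q"
  shows "algebra_isomorphic (twisted_group_algebra G (inflation a))
    (product_algebra chars (\<lambda>\<chi>. twisted_group_algebra Q (\<lambda>p\<in>carrier Q \<times> carrier Q. a p * tra_cocycle \<chi> p)))"
proof -
  let ?A = "twisted_group_algebra G (inflation a)"
  let ?b = "\<lambda>\<chi>. \<lambda>p\<in>carrier Q \<times> carrier Q. a p * tra_cocycle \<chi> p"
  let ?B = "product_algebra chars (\<lambda>\<chi>. twisted_group_algebra Q (?b \<chi>))"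
  define n where "n = complex_of_nat (card Z)"
  have n: "n \<noteq> 0"
    using finite_Z subgroup_Z by (auto simp: n_def dest: subgroup.one_closed)
  have fin: "finite chars"
    unfolding chars_eq using finite_Z by (intro K.finite_chars) simp
  have orth1: "(\<Sum>z\<in>Z. \<chi> z / \<psi> z) = (if \<chi> = \<psi> then n else 0)" if "\<chi> \<in> chars" "\<psi> \<in> chars" for \<chi> \<psi>
    using K.orthogonality_carrier[of \<chi> \<psi>] that finite_Z by (simp add: chars_eq n_def)
  have orth2: "(\<Sum>\<chi>\<in>chars. \<chi> z / \<chi> w) = (if z = w then n else 0)" if "z \<in> Z" "w \<in> Z" for z w
    using K.orthogonality_chars[of z w] that finite_Z by (simp add: chars_eq n_def)
  define F where "F = (\<lambda>v. \<lambda>\<chi>\<in>chars. fiber_sum G Q proj (\<lambda>g. \<chi> (rho g)) v)"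
  \<comment> \<open>Fourier inversion on each coset, identified with \<open>Z\<close> by
    \<open>rho\<close>; hence the division by \<open>n\<close>.\<close>
  define I where "I = (\<lambda>b. \<lambda>g\<in>carrier G. \<Sum>\<chi>\<in>chars. b \<chi> (proj g) / \<chi> (rho g) / n)"
  have bij: "bij_betw F (carrier ?A) (carrier ?B)"
  proof (rule bij_betwI[of _ _ _ I])
    show "F \<in> carrier ?A \<rightarrow> carrier ?B"
      by (auto simp: F_def product_algebra_def fiber_sum_def)
    show "I \<in> carrier ?B \<rightarrow> carrier ?A"
      by (auto simp: I_def)
    show "I (F v) = v" if v: "v \<in> carrier ?A" for v
    proof
      fix g
      show "I (F v) g = v g"
      proof (cases "g \<in> carrier G")
        case True
        have "I (F v) g = (\<Sum>\<chi>\<in>chars. \<Sum>h\<in>carrier G.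
            if proj h = proj g then \<chi> (rho h) / \<chi> (rho g) * (v h / n) else 0)"
          using True by (auto simp: I_def F_def fiber_sum_def sum_divide_distrib intro!: sum.cong)
        also have "\<dots> = (\<Sum>h\<in>carrier G. if proj h = proj g
            then (\<Sum>\<chi>\<in>chars. \<chi> (rho h) / \<chi> (rho g)) * (v h / n) else 0)"
          unfolding sum_distrib_right by (subst sum.swap) (auto intro!: sum.cong)
        \<comment> \<open>Orthogonality over the characters forces \<open>rho h = rho g\<close>;
          inside one coset this means \<open>h = g\<close>.\<close>
        also have "\<dots> = (\<Sum>h\<in>carrier G. if h = g then v h else 0)"
        proof (intro sum.cong refl)
          fix h assume h: "h \<in> carrier G"
          have "(\<Sum>\<chi>\<in>chars. \<chi> (rho h) / \<chi> (rho g)) = (if rho h = rho g then n else 0)"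
            using h True by (intro orth2) simp_all
          then show "(if proj h = proj g then (\<Sum>\<chi>\<in>chars. \<chi> (rho h) / \<chi> (rho g)) * (v h / n) else 0)
              = (if h = g then v h else 0)"
            using h True n eq_if_rho_eq[of h g] by (simp only:) auto
        qed
        finally show ?thesis
          using True finite_carrier by simp
      qed (use v in \<open>auto simp: I_def PiE_iff extensional_def\<close>)
    qed
    show "F (I b) = b" if b: "b \<in> carrier ?B" for b
    proof (intro ext)
      fix \<chi> x
      consider "\<chi> \<notin> chars" | "\<chi> \<in> chars" "x \<notin> carrier Q" | "\<chi> \<in> chars" "x \<in> carrier Q"
        by blast
      then show "F (I b) \<chi> x = b \<chi> x"
      proof cases
        case 1
        with b show ?thesis
          by (simp add: F_def product_algebra_def PiE_iff extensional_def)
      next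
        case 2
        with b show ?thesis
          by (simp add: F_def product_algebra_def fiber_sum_def PiE_iff extensional_def)
      next
        case 3
        have "F (I b) \<chi> x = (\<Sum>g\<in>carrier G. if proj g = x then
            (\<lambda>z. \<Sum>\<psi>\<in>chars. \<chi> z / \<psi> z * (b \<psi> x / n)) (rho g) else 0)"
          using 3 by (auto simp: I_def F_def fiber_sum_def sum_distrib_left intro!: sum.cong)
        also have "\<dots> = (\<Sum>z\<in>Z. \<Sum>\<psi>\<in>chars. \<chi> z / \<psi> z * (b \<psi> x / n))"
          by (rule sum_fiber[OF 3(2), where F = "\<lambda>z. \<Sum>\<psi>\<in>chars. \<chi> z / \<psi> z * (b \<psi> x / n)"])
        \<comment> \<open>In this direction the inner sum runs over \<open>Z\<close>, and
          orthogonality of two characters isolates \<chi>.\<close>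
        also have "\<dots> = (\<Sum>\<psi>\<in>chars. (\<Sum>z\<in>Z. \<chi> z / \<psi> z) * (b \<psi> x / n))"
          unfolding sum_distrib_right by (rule sum.swap)
        also have "\<dots> = (\<Sum>\<psi>\<in>chars. if \<chi> = \<psi> then b \<psi> x else 0)"
          using 3 n by (intro sum.cong refl) (simp add: orth1)
        finally show ?thesis
          using 3 fin by simp
      qed
    qed
  qed
  have rel: "\<chi> (rho (g \<otimes> h)) * inflation a (g, h) = \<chi> (rho g) * \<chi> (rho h) * ?b \<chi> (proj g, proj h)"
    if "\<chi> \<in> chars" "g \<in> carrier G" "h \<in> carrier G" for \<chi> g h
    using that by (simp add: char_rho_mult tra_cocycle_def)
  have nz: "\<chi> (rho \<one>) \<noteq> 0" "inflation a (\<one>, \<one>) \<noteq> 0" if "\<chi> \<in> chars" for \<chi>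
    using that cocycles_nonzero[OF inflation_cocycles[OF a]] by simp_all
  have mult: "fiber_sum G Q proj (\<lambda>g. \<chi> (rho g)) (v \<otimes>\<^bsub>?A\<^esub> w) = fiber_sum G Q proj (\<lambda>g. \<chi> (rho g)) v
      \<otimes>\<^bsub>twisted_group_algebra Q (?b \<chi>)\<^esub> fiber_sum G Q proj (\<lambda>g. \<chi> (rho g)) w" if "\<chi> \<in> chars" for \<chi> v w
    by (rule fiber_sum_mult[of G Q proj "\<lambda>g. \<chi> (rho g)" "inflation a" "?b \<chi>", OF is_group Q.is_group finite_carrier finite_Q proj_hom rel[OF that]])
  have one: "fiber_sum G Q proj (\<lambda>g. \<chi> (rho g)) \<one>\<^bsub>?A\<^esub> = \<one>\<^bsub>twisted_group_algebra Q (?b \<chi>)\<^esub>"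
    if "\<chi> \<in> chars" for \<chi>
    by (rule fiber_sum_one[of G Q proj "\<lambda>g. \<chi> (rho g)" "inflation a" "?b \<chi>", OF is_group Q.is_group finite_carrier proj_hom nz(1)[OF that] nz(2)[OF that] rel[OF that]])
  show ?thesis
  proof (rule algebra_isomorphicI[OF bij])
    show "F (x \<otimes>\<^bsub>?A\<^esub> y) = F x \<otimes>\<^bsub>?B\<^esub> F y" for x y
      by (simp add: F_def product_algebra_def mult fun_eq_iff)
    show "F (x \<oplus>\<^bsub>?A\<^esub> y) = F x \<oplus>\<^bsub>?B\<^esub> F y" for x y
      unfolding F_def product_algebra_def
      by (auto intro!: fiber_sum_add restrict_ext)
    show "F \<one>\<^bsub>?A\<^esub> = \<one>\<^bsub>?B\<^esub>"
      by (simp add: F_def product_algebra_def one fun_eq_iff)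
    show "F (c \<odot>\<^bsub>?A\<^esub> x) = c \<odot>\<^bsub>?B\<^esub> F x" for c x
      unfolding F_def product_algebra_def
      by (auto intro!: fiber_sum_smult restrict_ext)
  qed
qed

section \<open>Inflation on second cohomology\<close>

definition inf_class :: "('a set \<times> 'a set \<Rightarrow> complex) set \<Rightarrow> ('a \<times> 'a \<Rightarrow> complex) set" where
  "inf_class C = cohomology_class G (inflation (SOME a. a \<in> cocycles Q \<and> cohomology_class Q a = C))"

text \<open>By \<open>inflation_class_cong\<close> the representative picked by \<open>SOME\<close>
  does not affect the inflated class.\<close>

lemma inf_class_eq:
  assumes a: "a \<in> cocycles Q"
  shows "inf_class (cohomology_class Q a) = cohomology_class G (inflation a)"
proof -
  define b where "b = (SOME b. b \<in> cocycles Q \<and> cohomology_class Q b = cohomology_class Q a)"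
  have b: "b \<in> cocycles Q \<and> cohomology_class Q b = cohomology_class Q a"
    unfolding b_def by (rule someI[of _ a]) (use a in simp)
  then have "a \<in> cohomology_class Q b"
    using a Q.cohomology_class_eq_iff by blast
  then have "cohomology_class G (inflation b) = cohomology_class G (inflation a)"
    using b by (intro inflation_class_cong) auto
  then show ?thesis
    by (simp add: inf_class_def b_def)
qed

lemma inf_class_hom: "inf_class \<in> hom (second_cohomology Q) (second_cohomology G)"
proof (rule homI)
  fix C assume "C \<in> carrier (second_cohomology Q)"
  then show "inf_class C \<in> carrier (second_cohomology G)"
    by (auto simp: Q.carrier_second_cohomology carrier_second_cohomology inf_class_eq inflation_cocycles)
next
  fix C D assume "C \<in> carrier (second_cohomology Q)" "D \<in> carrier (second_cohomology Q)"
  then obtain a b where "a \<in> cocycles Q" "b \<in> cocycles Q" "C = cohomology_class Q a" "D = cohomology_class Q b"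
    by (auto simp: Q.carrier_second_cohomology)
  then show "inf_class (C \<otimes>\<^bsub>second_cohomology Q\<^esub> D) = inf_class C \<otimes>\<^bsub>second_cohomology G\<^esub> inf_class D"
    by (simp add: Q.second_cohomology_mult second_cohomology_mult inf_class_eq Q.cocycles_mult
        inflation_cocycles inflation_mult)
qed

text \<open>Exactness of the five-term sequence of the extension at the second cohomology of
  \<open>Q\<close>.\<close>

lemma inf_class_eq_one_iff:
  assumes "C \<in> carrier (second_cohomology Q)"
  shows "inf_class C = \<one>\<^bsub>second_cohomology G\<^esub> \<longleftrightarrow> C \<in> transgression G Z \<mu> ` chars"
proof -
  obtain a where a: "a \<in> cocycles Q" and C: "C = cohomology_class Q a"
    using assms by (auto simp: Q.carrier_second_cohomology)
  show ?thesis
  proof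
    assume "inf_class C = \<one>\<^bsub>second_cohomology G\<^esub>"
    then show "C \<in> transgression G Z \<mu> ` chars"
      using inflation_kernel[OF a] by (auto simp: C inf_class_eq[OF a] second_cohomology_one)
  next
    assume "C \<in> transgression G Z \<mu> ` chars"
    then obtain \<chi> where "\<chi> \<in> chars" "C = cohomology_class Q (tra_cocycle \<chi>)"
      by (auto simp: transgression_eq)
    then show "inf_class C = \<one>\<^bsub>second_cohomology G\<^esub>"
      by (simp add: inf_class_eq tra_cocycle_cocycles inflation_tra_cocycle second_cohomology_one)
  qed
qed

lemma inf_class_surjective:
  assumes "\<And>\<alpha> z g. \<lbrakk>\<alpha> \<in> cocycles G; z \<in> Z; g \<in> carrier G\<rbrakk> \<Longrightarrow> \<alpha> (z, g) = \<alpha> (g, z)"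
  shows "inf_class ` carrier (second_cohomology Q) = carrier (second_cohomology G)"
proof
  show "inf_class ` carrier (second_cohomology Q) \<subseteq> carrier (second_cohomology G)"
    using inf_class_hom by (auto simp: hom_def)
  show "carrier (second_cohomology G) \<subseteq> inf_class ` carrier (second_cohomology Q)"
  proof
    fix C assume "C \<in> carrier (second_cohomology G)"
    then obtain \<alpha> where \<alpha>: "\<alpha> \<in> cocycles G" "C = cohomology_class G \<alpha>"
      by (auto simp: carrier_second_cohomology)
    have "\<exists>a\<in>cocycles Q. cohomology_class G \<alpha> = cohomology_class G (inflation a)"
      by (rule inflation_surjective[OF \<alpha>(1)]) (rule assms[OF \<alpha>(1)])
    then obtain a where a: "a \<in> cocycles Q" "C = cohomology_class G (inflation a)"
      using \<alpha>(2) by blast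
    then have "C = inf_class (cohomology_class Q a)"
      by (simp add: inf_class_eq)
    then show "C \<in> inf_class ` carrier (second_cohomology Q)"
      using a by (auto simp: Q.carrier_second_cohomology)
  qed
qed

end

text \<open>Both targets are quotients of their sources by kernels that \<phi> matches. Surjections
  in place of factor groups avoid cosets of cohomology classes, which are cosets themselves.\<close>

lemma induced_iso_of_quotients:
  assumes "group A" "group A'" "group B" "group B'"
    and p: "p \<in> hom A A'" "p ` carrier A = carrier A'"
    and q: "q \<in> hom B B'" "q ` carrier B = carrier B'"
    and \<phi>: "\<phi> \<in> iso A B"
    and ker: "\<And>x. x \<in> carrier A \<Longrightarrow> p x = \<one>\<^bsub>A'\<^esub> \<longleftrightarrow> q (\<phi> x) = \<one>\<^bsub>B'\<^esub>"
  shows "\<exists>\<psi>\<in>iso A' B'. \<forall>x\<in>carrier A. \<psi> (p x) = q (\<phi> x)"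
proof -
  interpret A: group A by fact
  interpret p: group_hom A A' p
    using assms by (simp add: group_hom_def group_hom_axioms_def)
  have \<phi>_hom: "\<phi> \<in> hom A B" and \<phi>_bij: "\<phi> ` carrier A = carrier B"
    using \<phi> by (auto simp: iso_def bij_betw_def)
  then have "q \<circ> \<phi> \<in> hom A B'"
    using q by (intro hom_compose)
  then interpret r: group_hom A B' "q \<circ> \<phi>"
    using assms by (simp add: group_hom_def group_hom_axioms_def)
  have diff: "h x = h y \<longleftrightarrow> h (x \<otimes>\<^bsub>A\<^esub> inv\<^bsub>A\<^esub> y) = \<one>\<^bsub>K\<^esub>"
    if "group_hom A K h" "x \<in> carrier A" "y \<in> carrier A" for K :: "('z, 'n) monoid_scheme" and h x y
  proof -
    interpret h: group_hom A K h by fact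
    show ?thesis
      using that(2,3) h.H.inv_solve_right'[of "\<one>\<^bsub>K\<^esub>" "h x" "h y"] by auto
  qed
  \<comment> \<open>Matching kernels give matching fibres. This makes the choice in
    \<open>\<psi>\<close> harmless and also yields its injectivity.\<close>
  have eq: "p x = p y \<longleftrightarrow> q (\<phi> x) = q (\<phi> y)" if "x \<in> carrier A" "y \<in> carrier A" for x y
    using diff[OF p.group_hom_axioms that] diff[OF r.group_hom_axioms that] ker[of "x \<otimes>\<^bsub>A\<^esub> inv\<^bsub>A\<^esub> y"] that
    unfolding o_apply by (metis A.inv_closed A.m_closed)
  define \<psi> where "\<psi> = (\<lambda>y. q (\<phi> (SOME x. x \<in> carrier A \<and> p x = y)))"
  have \<psi>: "\<psi> (p x) = q (\<phi> x)" if x: "x \<in> carrier A" for x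
  proof -
    have "(SOME y. y \<in> carrier A \<and> p y = p x) \<in> carrier A \<and> p (SOME y. y \<in> carrier A \<and> p y = p x) = p x"
      by (rule someI[of _ x]) (use x in simp)
    then show ?thesis
      unfolding \<psi>_def using eq x by blast
  qed
  have "\<psi> \<in> hom A' B'"
  proof (rule homI)
    fix x assume "x \<in> carrier A'"
    then obtain a where "a \<in> carrier A" "x = p a"
      using p(2) by auto
    then show "\<psi> x \<in> carrier B'"
      using r.hom_closed by (simp add: \<psi>)
  next
    fix x y assume "x \<in> carrier A'" "y \<in> carrier A'"
    then obtain a b where ab: "a \<in> carrier A" "b \<in> carrier A" "x = p a" "y = p b"
      using p(2) by blast
    then show "\<psi> (x \<otimes>\<^bsub>A'\<^esub> y) = \<psi> x \<otimes>\<^bsub>B'\<^esub> \<psi> y"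
      using r.hom_mult[of a b] by (simp add: \<psi> flip: p.hom_mult)
  qed
  moreover have "bij_betw \<psi> (carrier A') (carrier B')"
  proof (rule bij_betw_imageI)
    show "inj_on \<psi> (carrier A')"
      unfolding p(2)[symmetric] by (auto simp: inj_on_def \<psi> eq)
    have "\<psi> ` carrier A' = (\<lambda>x. \<psi> (p x)) ` carrier A"
      by (simp add: image_image flip: p(2))
    also have "\<dots> = (\<lambda>x. q (\<phi> x)) ` carrier A"
      by (simp add: \<psi>)
    also have "\<dots> = carrier B'"
      using q(2) \<phi>_bij by (metis image_image)
    finally show "\<psi> ` carrier A' = carrier B'" .
  qed
  ultimately show ?thesis
    using \<psi> by (auto simp: iso_def)
qed

subsection \<open>Cocycles on central products\<close>

context group
begin

text \<open>For commuting elements the quotient is the commutator of their basis elements in the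
  twisted group algebra. It is a scalar, hence multiplicative in either entry.\<close>

lemma cocycle_commutator_mult:
  assumes \<alpha>: "\<alpha> \<in> cocycles G" and xy: "x \<in> carrier G" "x' \<in> carrier G" "y \<in> carrier G"
    and comm: "x \<otimes> y = y \<otimes> x" "x' \<otimes> y = y \<otimes> x'"
  shows "\<alpha> (x \<otimes> x', y) / \<alpha> (y, x \<otimes> x') = \<alpha> (x, y) / \<alpha> (y, x) * (\<alpha> (x', y) / \<alpha> (y, x'))"
proof -
  note nz = cocycles_nonzero[OF \<alpha>]
  have 1: "\<alpha> (x, x') * \<alpha> (x \<otimes> x', y) = \<alpha> (x', y) * \<alpha> (x, y \<otimes> x')"
    using cocycles_identity[OF \<alpha>, of x x' y] xy comm by simp
  have 2: "\<alpha> (x, y) * \<alpha> (y \<otimes> x, x') = \<alpha> (y, x') * \<alpha> (x, y \<otimes> x')"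
    using cocycles_identity[OF \<alpha>, of x y x'] xy comm by simp
  have 3: "\<alpha> (y, x) * \<alpha> (y \<otimes> x, x') = \<alpha> (x, x') * \<alpha> (y, x \<otimes> x')"
    using cocycles_identity[OF \<alpha>, of y x x'] xy by simp
  \<comment> \<open>The three instances have \<open>y\<close> to the right of \<open>x\<close> and
    \<open>x'\<close>, between them, and to their left. In their product
    \<open>\<alpha> (x, x')\<close>, \<open>\<alpha> (y \<otimes> x, x')\<close> and
    \<open>\<alpha> (x, y \<otimes> x')\<close> cancel.\<close>
  have "\<alpha> (x, x') * \<alpha> (x \<otimes> x', y) * (\<alpha> (y, x) * \<alpha> (y \<otimes> x, x')) * (\<alpha> (y, x') * \<alpha> (x, y \<otimes> x'))
    = \<alpha> (x', y) * \<alpha> (x, y \<otimes> x') * (\<alpha> (x, x') * \<alpha> (y, x \<otimes> x')) * (\<alpha> (x, y) * \<alpha> (y \<otimes> x, x'))"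
    by (simp only: 1 2 3)
  then have "\<alpha> (x \<otimes> x', y) * (\<alpha> (y, x) * \<alpha> (y, x')) = \<alpha> (x, y) * \<alpha> (x', y) * \<alpha> (y, x \<otimes> x')"
    using nz[of x x'] nz[of "y \<otimes> x" x'] nz[of x "y \<otimes> x'"] xy by simp
  then show ?thesis
    using nz[of y x] nz[of y x'] nz[of y "x \<otimes> x'"] xy by (simp add: divide_simps)
qed

lemma cocycle_symmetric_derived:
  assumes \<alpha>: "\<alpha> \<in> cocycles G" and K: "subgroup K G" and y: "y \<in> carrier G"
    and comm: "\<And>x. x \<in> K \<Longrightarrow> x \<otimes> y = y \<otimes> x"
    and z: "z \<in> derived G K"
  shows "\<alpha> (z, y) = \<alpha> (y, z)"
proof -
  interpret K: subgroup K G by fact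
  \<comment> \<open>\<open>c\<close> is a homomorphism from \<open>K\<close> to an abelian group, hence trivial on commutators.\<close>
  define c where "c = (\<lambda>x. \<alpha> (x, y) / \<alpha> (y, x))"
  have c0: "c x \<noteq> 0" if "x \<in> K" for x
    using that y by (simp add: c_def cocycles_nonzero[OF \<alpha>])
  have c_mult: "c (x \<otimes> x') = c x * c x'" if "x \<in> K" "x' \<in> K" for x x'
    unfolding c_def by (rule cocycle_commutator_mult[OF \<alpha>]) (use that y comm in auto)
  have c_one: "c \<one> = 1"
    using c_mult[of \<one> \<one>] c0[of \<one>] by simp
  have c_inv: "c (inv x) = inverse (c x)" if "x \<in> K" for x
    using c_mult[of x "inv x"] that c_one by (simp add: inverse_unique)
  have "subgroup {x \<in> K. c x = 1} G"
    by (rule subgroupI) (auto simp: c_mult c_inv c_one intro!: exI[of _ \<one>])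
  moreover have "derived_set G K \<subseteq> {x \<in> K. c x = 1}"
  proof -
    have "c (h1 \<otimes> h2 \<otimes> inv h1 \<otimes> inv h2) = 1" if "h1 \<in> K" "h2 \<in> K" for h1 h2
      using that c0[OF that(1)] c0[OF that(2)] by (simp add: c_mult c_inv field_simps)
    then show ?thesis
      by auto
  qed
  ultimately have "derived G K \<subseteq> {x \<in> K. c x = 1}"
    unfolding derived_def by (rule generate_subgroup_incl[rotated])
  with z show ?thesis
    using y by (auto simp: c_def cocycles_nonzero[OF \<alpha>])
qed

lemma central_product_commute:
  assumes cp: "central_product G G1 G2" and xy: "x \<in> G1" "y \<in> G2"
  shows "x \<otimes> y = y \<otimes> x"
proof -
  have "x \<in> carrier G" "y \<in> carrier G" "x \<otimes> y \<otimes> inv x \<otimes> inv y = \<one>"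
    using assms by (auto simp: central_product_def dest: normal_imp_subgroup subgroup.mem_carrier)
  then show ?thesis
    by (metis inv_closed inv_solve_right l_one m_closed one_closed)
qed

lemma central_product_subgroups:
  assumes "central_product G G1 G2"
  shows "subgroup G1 G" and "subgroup G2 G"
  using assms by (auto simp: central_product_def normal_imp_subgroup)

lemma central_product_mem:
  assumes "central_product G G1 G2" and "g \<in> carrier G"
  obtains x y where "x \<in> G1" "y \<in> G2" "g = x \<otimes> y"
  using assms by (auto simp: central_product_def set_mult_def)

lemma central_product_inter_central:
  assumes cp: "central_product G G1 G2" and z: "z \<in> G1" "z \<in> G2" and g: "g \<in> carrier G"
  shows "z \<otimes> g = g \<otimes> z"
proof -
  obtain x y where xy: "x \<in> G1" "y \<in> G2" "g = x \<otimes> y"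
    using cp g by (rule central_product_mem)
  note sub = central_product_subgroups[OF cp]
  have "x \<in> carrier G" "y \<in> carrier G" "z \<in> carrier G"
    using xy z sub by (auto dest: subgroup.mem_carrier)
  moreover have "z \<otimes> y = y \<otimes> z" "z \<otimes> x = x \<otimes> z"
    using central_product_commute[OF cp, of z y] central_product_commute[OF cp, of x z] xy z by simp_all
  ultimately show ?thesis
    unfolding xy by (metis m_assoc)
qed

text \<open>The two memberships of \<open>z\<close> are used crosswise: as an element of the derived
  subgroup of \<open>G1\<close> it pairs trivially with the \<open>G2\<close>-part of
  \<open>g\<close>, and the other way round.\<close>

lemma central_product_cocycle_symmetric:
  assumes cp: "central_product G G1 G2" and \<alpha>: "\<alpha> \<in> cocycles G"
    and z: "z \<in> derived G G1" "z \<in> derived G G2" and g: "g \<in> carrier G"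
  shows "\<alpha> (z, g) = \<alpha> (g, z)"
proof -
  obtain x y where xy: "x \<in> G1" "y \<in> G2" "g = x \<otimes> y"
    using cp g by (rule central_product_mem)
  note sub = central_product_subgroups[OF cp]
  have z12: "z \<in> G1" "z \<in> G2"
    using z sub derived_incl by blast+
  have carr: "x \<in> carrier G" "y \<in> carrier G" "z \<in> carrier G"
    using xy z12 sub by (auto dest: subgroup.mem_carrier)
  have "\<alpha> (z, y) = \<alpha> (y, z)"
    by (rule cocycle_symmetric_derived[OF \<alpha> sub(1)])
      (use z xy carr central_product_commute[OF cp] in auto)
  moreover have "\<alpha> (z, x) = \<alpha> (x, z)"
    by (rule cocycle_symmetric_derived[OF \<alpha> sub(2)])
      (use z xy carr central_product_commute[OF cp, of x] in auto)
  moreover have "\<alpha> (x \<otimes> y, z) / \<alpha> (z, x \<otimes> y) = \<alpha> (x, z) / \<alpha> (z, x) * (\<alpha> (y, z) / \<alpha> (z, y))"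
    by (rule cocycle_commutator_mult[OF \<alpha>])
      (use carr central_product_inter_central[OF cp z12] in auto)
  ultimately have "\<alpha> (x \<otimes> y, z) / \<alpha> (z, x \<otimes> y) = 1"
    using carr by (simp add: cocycles_nonzero[OF \<alpha>])
  then show ?thesis
    by (simp add: xy)
qed

lemma central_product_central_extension:
  assumes cp: "central_product G G1 G2" and fin: "finite (carrier G)"
    and sec: "is_section G (derived G G1 \<inter> derived G G2) \<mu>"
  shows "central_extension G (derived G G1 \<inter> derived G G2) \<mu>"
proof (intro central_extension.intro central_extension_axioms.intro is_group fin sec)
  note sub = central_product_subgroups[OF cp]
  show "subgroup (derived G G1 \<inter> derived G G2) G"
    by (rule subgroups_Inter_pair[OF derived_is_subgroup[OF subgroup.subset[OF sub(1)]]
          derived_is_subgroup[OF subgroup.subset[OF sub(2)]]])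
  fix z g assume "z \<in> derived G G1 \<inter> derived G G2" "g \<in> carrier G"
  then show "z \<otimes> g = g \<otimes> z"
    using derived_incl[OF subset_refl sub(1)] derived_incl[OF subset_refl sub(2)]
    by (intro central_product_inter_central[OF cp]) auto
qed

end

section \<open>Descent to the two groups and comparison of their algebras\<close>

theorem theorem1p6:
  fixes G :: "('a, 'm) monoid_scheme" and G1 G2 Z1 :: "'a set"
    and H :: "('b, 'n) monoid_scheme" and H1 H2 Z2 :: "'b set"
    and \<phi> :: "('a set \<times> 'a set \<Rightarrow> complex) set \<Rightarrow> ('b set \<times> 'b set \<Rightarrow> complex) set"
    and i :: "('a \<Rightarrow> complex) \<Rightarrow> ('b \<Rightarrow> complex)"
    and \<mu>1 :: "'a set \<Rightarrow> 'a" and \<mu>2 :: "'b set \<Rightarrow> 'b"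
  assumes "group G" and "finite (carrier G)" and "central_product G G1 G2"
    and "group H" and "finite (carrier H)" and "central_product H H1 H2"
    and "Z1 = derived G G1 \<inter> derived G G2"
    and "Z2 = derived H H1 \<inter> derived H H2"
    and "is_section G Z1 \<mu>1" and "is_section H Z2 \<mu>2"
    and "sim_via (G Mod Z1) (H Mod Z2) \<phi>"
    and "i \<in> iso (character_group G Z1) (character_group H Z2)"
    and "\<forall>\<chi>\<in>carrier (character_group G Z1).
           \<phi> (transgression G Z1 \<mu>1 \<chi>) = transgression H Z2 \<mu>2 (i \<chi>)"
  shows "sim G H"
proof -
  interpret G: central_extension G Z1 \<mu>1
    using group.central_product_central_extension[of G G1 G2 \<mu>1] assms by simp
  interpret H: central_extension H Z2 \<mu>2
    using group.central_product_central_extension[of H H1 H2 \<mu>2] assms by simp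
  have symG: "\<alpha> (z, g) = \<alpha> (g, z)" if "\<alpha> \<in> cocycles G" "z \<in> Z1" "g \<in> carrier G" for \<alpha> z g
    using that assms(7) by (auto intro: G.central_product_cocycle_symmetric[OF assms(3)])
  have symH: "\<alpha> (z, g) = \<alpha> (g, z)" if "\<alpha> \<in> cocycles H" "z \<in> Z2" "g \<in> carrier H" for \<alpha> z g
    using that assms(8) by (auto intro: H.central_product_cocycle_symmetric[OF assms(6)])
  have \<phi>: "\<phi> \<in> iso (second_cohomology G.Q) (second_cohomology H.Q)"
    and \<phi>_alg: "\<And>a b. \<lbrakk>a \<in> cocycles G.Q; b \<in> \<phi> (cohomology_class G.Q a)\<rbrakk>
      \<Longrightarrow> algebra_isomorphic (twisted_group_algebra G.Q a) (twisted_group_algebra H.Q b)"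
    using assms(11) by (auto simp: sim_via_def)
  have i: "bij_betw i G.chars H.chars"
    using assms(12) by (simp add: iso_def)
  have \<phi>_mem: "\<phi> C \<in> carrier (second_cohomology H.Q)" if "C \<in> carrier (second_cohomology G.Q)" for C
    using \<phi> that by (auto simp: iso_def hom_def)
  have tra_mem: "transgression G Z1 \<mu>1 \<chi> \<in> carrier (second_cohomology G.Q)" if "\<chi> \<in> G.chars" for \<chi>
    using that by (simp add: G.transgression_eq G.Q.carrier_second_cohomology G.tra_cocycle_cocycles)
  \<comment> \<open>By exactness these images are the kernels of the two inflation maps. The
    direction from \<open>H\<close> back to \<open>G\<close> combines surjectivity of
    \<open>i\<close> with injectivity of \<phi>.\<close>
  have img: "\<phi> C \<in> transgression H Z2 \<mu>2 ` H.chars \<longleftrightarrow> C \<in> transgression G Z1 \<mu>1 ` G.chars"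
    if C: "C \<in> carrier (second_cohomology G.Q)" for C
  proof
    assume "\<phi> C \<in> transgression H Z2 \<mu>2 ` H.chars"
    then obtain \<chi> where \<chi>: "\<chi> \<in> G.chars" "\<phi> C = transgression H Z2 \<mu>2 (i \<chi>)"
      unfolding bij_betw_imp_surj_on[OF i, symmetric] by blast
    then have "\<phi> C = \<phi> (transgression G Z1 \<mu>1 \<chi>)"
      using assms(13) by simp
    then have "C = transgression G Z1 \<mu>1 \<chi>"
      using \<phi> C tra_mem[OF \<chi>(1)] by (auto simp: iso_def bij_betw_def dest: inj_onD)
    with \<chi> show "C \<in> transgression G Z1 \<mu>1 ` G.chars"
      by blast
  next
    assume "C \<in> transgression G Z1 \<mu>1 ` G.chars"
    then show "\<phi> C \<in> transgression H Z2 \<mu>2 ` H.chars"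
      using assms(13) i by (auto dest: bij_betwE)
  qed
  obtain \<psi> where \<psi>: "\<psi> \<in> iso (second_cohomology G) (second_cohomology H)"
    and \<psi>_inf: "\<And>C. C \<in> carrier (second_cohomology G.Q) \<Longrightarrow> \<psi> (G.inf_class C) = H.inf_class (\<phi> C)"
    using induced_iso_of_quotients[OF G.Q.group_second_cohomology G.group_second_cohomology
        H.Q.group_second_cohomology H.group_second_cohomology
        G.inf_class_hom G.inf_class_surjective[OF symG] H.inf_class_hom H.inf_class_surjective[OF symH] \<phi>]
    by (auto simp: G.inf_class_eq_one_iff H.inf_class_eq_one_iff \<phi>_mem img)
  have "algebra_isomorphic (twisted_group_algebra G \<alpha>) (twisted_group_algebra H \<beta>)"
    if \<alpha>: "\<alpha> \<in> cocycles G" and \<beta>: "\<beta> \<in> \<psi> (cohomology_class G \<alpha>)" for \<alpha> \<beta>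
  proof -
    \<comment> \<open>An inflated representative of the class changes the algebra only by an
      isomorphism; the cocycle \<open>b\<close> plays the same part for \<beta>.\<close>
    obtain a where a: "a \<in> cocycles G.Q" and \<alpha>a: "cohomology_class G \<alpha> = cohomology_class G (G.inflation a)"
      using G.inflation_surjective[OF \<alpha>] symG[OF \<alpha>] by blast
    have Ca: "cohomology_class G.Q a \<in> carrier (second_cohomology G.Q)"
      using a by (simp add: G.Q.carrier_second_cohomology)
    then obtain b where b: "b \<in> cocycles H.Q" and \<phi>a: "\<phi> (cohomology_class G.Q a) = cohomology_class H.Q b"
      using \<phi>_mem by (auto simp: H.Q.carrier_second_cohomology)
    have "\<beta> \<in> cohomology_class H (H.inflation b)"
      using \<beta> \<psi>_inf[OF Ca] a b by (simp add: \<alpha>a \<phi>a G.inf_class_eq H.inf_class_eq)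
    then have bb: "algebra_isomorphic (twisted_group_algebra H (H.inflation b)) (twisted_group_algebra H \<beta>)"
      using assms(4,5) b H.inflation_cocycles by (intro algebra_isomorphic_cohomologous) auto
    have "G.inflation a \<in> cohomology_class G \<alpha>"
      using \<alpha> a \<alpha>a G.cohomology_class_self G.inflation_cocycles by metis
    then have aa: "algebra_isomorphic (twisted_group_algebra G \<alpha>) (twisted_group_algebra G (G.inflation a))"
      using assms(1,2) \<alpha> by (intro algebra_isomorphic_cohomologous) auto
    let ?a = "\<lambda>\<chi>. \<lambda>p\<in>carrier G.Q \<times> carrier G.Q. a p * G.tra_cocycle \<chi> p"
    let ?b = "\<lambda>\<chi>. \<lambda>p\<in>carrier H.Q \<times> carrier H.Q. b p * H.tra_cocycle \<chi> p"
    have "algebra_isomorphic (twisted_group_algebra G.Q (?a \<chi>)) (twisted_group_algebra H.Q (?b (i \<chi>)))"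
      if \<chi>: "\<chi> \<in> G.chars" for \<chi>
    proof (rule \<phi>_alg)
      have i\<chi>: "i \<chi> \<in> H.chars"
        using i \<chi> by (auto dest: bij_betwE)
      note ta = G.tra_cocycle_cocycles[OF \<chi>] and tb = H.tra_cocycle_cocycles[OF i\<chi>]
      show "?a \<chi> \<in> cocycles G.Q"
        using a ta by (rule G.Q.cocycles_mult)
      \<comment> \<open>As \<phi> is a homomorphism compatible with transgression, the twist of
        \<open>a\<close> by \<chi> corresponds to the twist of \<open>b\<close> by
        \<open>i \<chi>\<close>; thus \<open>i\<close> is the bijection of factors.\<close>
      have "\<phi> (cohomology_class G.Q (?a \<chi>))
          = \<phi> (cohomology_class G.Q a \<otimes>\<^bsub>second_cohomology G.Q\<^esub> transgression G Z1 \<mu>1 \<chi>)"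
        by (simp add: G.transgression_eq G.Q.second_cohomology_mult a ta)
      also have "\<dots> = \<phi> (cohomology_class G.Q a) \<otimes>\<^bsub>second_cohomology H.Q\<^esub> \<phi> (transgression G Z1 \<mu>1 \<chi>)"
        using \<phi> Ca tra_mem[OF \<chi>] by (auto simp: iso_def hom_mult)
      also have "\<dots> = cohomology_class H.Q (?b (i \<chi>))"
        using assms(13) \<chi> by (simp add: \<phi>a H.transgression_eq H.Q.second_cohomology_mult b tb)
      finally show "?b (i \<chi>) \<in> \<phi> (cohomology_class G.Q (?a \<chi>))"
        using H.Q.cohomology_class_self[OF H.Q.cocycles_mult[OF b tb]] by simp
    qed
    then have "algebra_isomorphic (product_algebra G.chars (\<lambda>\<chi>. twisted_group_algebra G.Q (?a \<chi>)))
        (product_algebra H.chars (\<lambda>\<chi>. twisted_group_algebra H.Q (?b \<chi>)))"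
      by (intro algebra_isomorphic_product[OF i])
    from algebra_isomorphic_trans[OF G.algebra_isomorphic_inflation[OF a] this]
    have "algebra_isomorphic (twisted_group_algebra G (G.inflation a)) (twisted_group_algebra H (H.inflation b))"
      by (rule algebra_isomorphic_trans[OF _ algebra_isomorphic_twisted_sym[OF H.algebra_isomorphic_inflation[OF b]]])
    from algebra_isomorphic_trans[OF algebra_isomorphic_trans[OF aa this] bb] show ?thesis .
  qed
  with \<psi> show ?thesis
    unfolding sim_def sim_via_def by blast
qed

end
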